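(* Consider the source coding problem with receiver side information described in the context, let $\mathcal{R}$ be its set of achievable rate triples, and let $\mathcal{R}_{in}$ be as defined in the context. Then $\mathcal{R}\supseteq\mathcal{R}_{in}$.
   Context: Let $\mathcal{X},\mathcal{Y},\mathcal{U},\mathcal{V}$ be finite sets and let $\{(X_i,Y_i,U_i,V_i)\}_{i\ge1}$ be i.i.d. with joint distribution $\mathcal{Q}_{XYUV}$. For $i=0,1,2$ let $\mathcal{M}_i=\{1,\dots,|\mathcal{M}_i|\}$ be finite index sets. A code of block length $n$ consists of an encoder $e^{(n)}:\mathcal{X}^n\times\mathcal{Y}^n\to\mathcal{M}_0\times\mathcal{M}_1\times\mathcal{M}_2$, $(M_0,M_1,M_2)=e^{(n)}(X^n,Y^n)$, a decoder $d_x^{(n)}:\mathcal{M}_0\times\mathcal{M}_1\times\mathcal{U}^n\to\mathcal{X}^n$, $\widehat X^n=d_x^{(n)}(M_0,M_1,U^n)$, and a decoder $d_y^{(n)}:\mathcal{M}_0\times\mathcal{M}_2\times\mathcal{V}^n\to\mathcal{Y}^n$, $\widehat Y^n=d_y^{(n)}(M_0,M_2,V^n)$. Let $P_e=\max\{\Pr[\widehat X^n\ne X^n],\Pr[\widehat Y^n\ne Y^n]\}$. A triple $(R_0,R_1,R_2)$ is achievable if for every $\epsilon>0$ and all sufficiently large $n$ there is such a code with $P_e\le\epsilon$ and $(1/n)\log_2|\mathcal{M}_i|\le R_i+\epsilon$, $i=0,1,2$; $\mathcal{R}$ is the set of achievable triples. Let $\mathcal{W}$ be a finite set with $|\mathcal{W}|\le|\mathcal{X}||\mathcal{Y}|+3$,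 and let $\mathcal{P}$ be the family of probability functions $p$ on $\mathcal{W}\times\mathcal{X}\times\mathcal{Y}\times\mathcal{U}\times\mathcal{V}$ with $p(w,x,y,u,v)=p(w|x,y)p(x,y,u,v)$ and $\sum_w p(w,x,y,u,v)=\mathcal{Q}_{XYUV}(x,y,u,v)$. For $p\in\mathcal{P}$ let $\mathcal{R}_{in}^{(p)}$ be the set of $(R_0,R_1,R_2)$ with $R_0\ge\max\{I_p(X,Y;W|U),I_p(X,Y;W|V)\}$, $R_1\ge H_p(X|W,U)$, $R_2\ge H_p(Y|W,V)$, and let $\mathcal{R}_{in}$ be the closure of $\bigcup_{p\in\mathcal{P}}\mathcal{R}_{in}^{(p)}$. *)

theory Defs
  imports "HOL-Analysis.Analysis" "HOL-Probability.Probability_Mass_Function"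
begin

text \<open>p is a probability function on a finite sample space; f, g, h are random variables
  (functions of the outcome). Entropy uses the convention 0 log 0 = 0 (automatic, since
  the summand is q * log 2 q and q = 0 gives 0).\<close>

definition ent :: "('o::finite \<Rightarrow> real) \<Rightarrow> ('o \<Rightarrow> 'z) \<Rightarrow> real" where
  "ent p f = - (\<Sum>z\<in>f ` UNIV. (\<Sum>\<omega>\<in>{\<omega>. f \<omega> = z}. p \<omega>) * log 2 (\<Sum>\<omega>\<in>{\<omega>. f \<omega> = z}. p \<omega>))"

definition cent :: "('o::finite \<Rightarrow> real) \<Rightarrow> ('o \<Rightarrow> 'z) \<Rightarrow> ('o \<Rightarrow> 'b) \<Rightarrow> real" where
  "cent p f g = ent p (\<lambda>\<omega>. (f \<omega>, g \<omega>)) - ent p g"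

definition cmi :: "('o::finite \<Rightarrow> real) \<Rightarrow> ('o \<Rightarrow> 'z) \<Rightarrow> ('o \<Rightarrow> 'b) \<Rightarrow> ('o \<Rightarrow> 'c) \<Rightarrow> real" where
  "cmi p f g h = cent p f h - cent p f (\<lambda>\<omega>. (g \<omega>, h \<omega>))"

definition iid_prob :: "'a pmf \<Rightarrow> 'a list \<Rightarrow> real" where
  "iid_prob Q zs = prod_list (map (pmf Q) zs)"

definition is_code :: "nat \<Rightarrow> nat \<Rightarrow> nat \<Rightarrow> nat \<Rightarrow> ('x list \<Rightarrow> 'y list \<Rightarrow> nat \<times> nat \<times> nat) \<Rightarrow> bool" where
  "is_code n m0 m1 m2 e \<longleftrightarrow>
     (\<forall>xs ys. length xs = n \<longrightarrow> length ys = n \<longrightarrow>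
        fst (e xs ys) \<in> {1..m0} \<and> fst (snd (e xs ys)) \<in> {1..m1} \<and> snd (snd (e xs ys)) \<in> {1..m2})"

definition err_x :: "('x::finite \<times> 'y::finite \<times> 'u::finite \<times> 'v::finite) pmf \<Rightarrow> nat \<Rightarrow>
    ('x list \<Rightarrow> 'y list \<Rightarrow> nat \<times> nat \<times> nat) \<Rightarrow> (nat \<Rightarrow> nat \<Rightarrow> 'u list \<Rightarrow> 'x list) \<Rightarrow> real" where
  "err_x Q n e dx = (\<Sum>zs\<in>{zs. length zs = n}.
     (let xs = map fst zs; ys = map (fst \<circ> snd) zs; us = map (fst \<circ> snd \<circ> snd) zs;
          (a, b, c) = e xs ys
      in if dx a b us \<noteq> xs then iid_prob Q zs else 0))"

definition err_y :: "('x::finite \<times> 'y::finite \<times> 'u::finite \<times> 'v::finite) pmf \<Rightarrow> nat \<Rightarrow>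
    ('x list \<Rightarrow> 'y list \<Rightarrow> nat \<times> nat \<times> nat) \<Rightarrow> (nat \<Rightarrow> nat \<Rightarrow> 'v list \<Rightarrow> 'y list) \<Rightarrow> real" where
  "err_y Q n e dy = (\<Sum>zs\<in>{zs. length zs = n}.
     (let xs = map fst zs; ys = map (fst \<circ> snd) zs; vs = map (snd \<circ> snd \<circ> snd) zs;
          (a, b, c) = e xs ys
      in if dy a c vs \<noteq> ys then iid_prob Q zs else 0))"

definition achievable :: "('x::finite \<times> 'y::finite \<times> 'u::finite \<times> 'v::finite) pmf \<Rightarrow> real \<times> real \<times> real \<Rightarrow> bool" where
  "achievable Q R \<longleftrightarrow> (case R of (R0, R1, R2) \<Rightarrow>
     (\<forall>\<epsilon>>0. \<exists>N. \<forall>n\<ge>N. \<exists>m0 m1 m2 e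
        (dx :: nat \<Rightarrow> nat \<Rightarrow> 'u list \<Rightarrow> 'x list) (dy :: nat \<Rightarrow> nat \<Rightarrow> 'v list \<Rightarrow> 'y list).
        is_code n m0 m1 m2 e \<and>
        max (err_x Q n e dx) (err_y Q n e dy) \<le> \<epsilon> \<and>
        log 2 (real m0) / real n \<le> R0 + \<epsilon> \<and>
        log 2 (real m1) / real n \<le> R1 + \<epsilon> \<and>
        log 2 (real m2) / real n \<le> R2 + \<epsilon>))"

definition cond_kernels :: "('x \<Rightarrow> 'y \<Rightarrow> 'w::finite \<Rightarrow> real) set" where
  "cond_kernels = {c. (\<forall>x y w. 0 \<le> c x y w) \<and> (\<forall>x y. (\<Sum>w\<in>UNIV. c x y w) = 1)}"

definition joint_p :: "('x \<Rightarrow> 'y \<Rightarrow> 'w \<Rightarrow> real) \<Rightarrow> ('x \<times> 'y \<times> 'u \<times> 'v) pmf \<Rightarrow>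
    ('w \<times> 'x \<times> 'y \<times> 'u \<times> 'v \<Rightarrow> real)" where
  "joint_p c Q = (\<lambda>(w, x, y, u, v). c x y w * pmf Q (x, y, u, v))"

definition Rin_p :: "('w::finite \<times> 'x::finite \<times> 'y::finite \<times> 'u::finite \<times> 'v::finite \<Rightarrow> real) \<Rightarrow> (real \<times> real \<times> real) set" where
  "Rin_p p = {(R0, R1, R2).
     R0 \<ge> max (cmi p (\<lambda>(w,x,y,u,v). (x,y)) (\<lambda>(w,x,y,u,v). w) (\<lambda>(w,x,y,u,v). u))
                (cmi p (\<lambda>(w,x,y,u,v). (x,y)) (\<lambda>(w,x,y,u,v). w) (\<lambda>(w,x,y,u,v). v)) \<and>
     R1 \<ge> cent p (\<lambda>(w,x,y,u,v). x) (\<lambda>(w,x,y,u,v). (w,u)) \<and>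
     R2 \<ge> cent p (\<lambda>(w,x,y,u,v). y) (\<lambda>(w,x,y,u,v). (w,v))}"

end

theory Submission
  imports Defs
begin

text \<open>
  Draw \<open>W\<^sup>n\<close> from the kernel \<open>p(w|x,y)\<close> and hash it twice, \<open>F = F(W\<^sup>n)\<close> and \<open>M\<^sub>0 = G(W\<^sup>n)\<close>.
  If the rate of \<open>F\<close> is just below \<open>H(W|X,Y)\<close>, the leftover hash lemma makes \<open>F\<close> almost uniform
  and independent of \<open>(X\<^sup>n,Y\<^sup>n)\<close>, so \<open>F\<close> may be replaced by a constant known to everybody. If the joint
  rate of \<open>(F,G)\<close> exceeds \<open>H(W|U)\<close> and \<open>H(W|V)\<close>, each receiver recovers \<open>W\<^sup>n\<close> from \<open>(F,M\<^sub>0)\<close> and its side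
  information. Hence \<open>M\<^sub>0\<close> only costs the rate \<open>max {H(W|U), H(W|V)} - H(W|X,Y)\<close>, which is
  \<open>max {I(X,Y;W|U), I(X,Y;W|V)}\<close> because \<open>(U,V)\<close> and \<open>W\<close> are conditionally independent given \<open>(X,Y)\<close>.
  Knowing \<open>W\<^sup>n\<close>, the receivers decode \<open>X\<^sup>n\<close> and \<open>Y\<^sup>n\<close> from hashes of rates \<open>H(X|W,U)\<close> and \<open>H(Y|W,V)\<close>.
\<close>

section \<open>Universal hashing\<close>

text \<open>The obstacle is that \<open>W\<close> must fit \<open>U\<close> and \<open>V\<close>,
  which the encoder never sees. A covering argument would pick some sequence typical with the source
  and then need a Markov lemma to recover its typicality with the side information. Here the
  analysis runs under the i.i.d. law of \<open>(W,X,Y,U,V)\<close>, where every typicality statement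
  is a law of large numbers. The price for using this law is the expected L1 distance between the
  conditional law of \<open>F\<close> and the uniform law. Both receivers rely on the same
  \<open>F\<close> and \<open>M\<^sub>0\<close>, so one pair of hashes must serve two decoders and
  also make \<open>F\<close> nearly uniform. Random hashes meet each demand on average, so the three
  averages are added before a pair is chosen. All tail estimates are one-sided and come from
  Chebyshev's inequality for sums of logarithms along a block; no counting of types is
  involved.\<close>

text \<open>\<kappa> bounds the collision probability under a uniformly drawn key. Keys are kept
  apart from the functions they name so that a pair of independently drawn hashes is again such a
  family.\<close>

definition universal_hash :: "'h set \<Rightarrow> ('h \<Rightarrow> 'a \<Rightarrow> 'b) \<Rightarrow> 'a set \<Rightarrow> real \<Rightarrow> bool" where
  "universal_hash H hf A \<kappa> \<longleftrightarrow> finite H \<and> H \<noteq> {} \<and>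
     (\<forall>a\<in>A. \<forall>b\<in>A. a \<noteq> b \<longrightarrow> real (card {h\<in>H. hf h a = hf h b}) \<le> \<kappa> * real (card H))"

text \<open>A function with equal values at a and b is determined by its restriction to
  \<open>A - {a}\<close>, since the lost value can be read off at b. This leaves one factor m fewer
  than for all functions.\<close>

lemma universal_hash_PiE:
  fixes A :: "'a set" and m :: nat
  assumes "finite A" and "1 \<le> m"
  shows "universal_hash (A \<rightarrow>\<^sub>E {1..m}) (\<lambda>h. h) A (1 / real m)"
proof -
  have "real (card {h \<in> A \<rightarrow>\<^sub>E {1..m}. h a = h b}) \<le> 1 / real m * real (card (A \<rightarrow>\<^sub>E {1..m}))"
    if ab: "a \<in> A" "b \<in> A" "a \<noteq> b" for a b
  proof -
    have "card {h \<in> A \<rightarrow>\<^sub>E {1..m}. h a = h b} \<le> card ((A - {a}) \<rightarrow>\<^sub>E {1..m})"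
    proof (rule card_inj_on_le[where f = "\<lambda>h. restrict h (A - {a})"])
      show "inj_on (\<lambda>h. restrict h (A - {a})) {h \<in> A \<rightarrow>\<^sub>E {1..m}. h a = h b}"
      proof (rule inj_onI, rule ext)
        fix h k x
        assume h: "h \<in> {h \<in> A \<rightarrow>\<^sub>E {1..m}. h a = h b}"
          and k: "k \<in> {h \<in> A \<rightarrow>\<^sub>E {1..m}. h a = h b}"
          and eq: "restrict h (A - {a}) = restrict k (A - {a})"
        have *: "h y = k y" if "y \<in> A" "y \<noteq> a" for y
          using fun_cong[OF eq, of y] that by simp
        show "h x = k x"
          using h k ab * [of x] * [of b]
          by (cases "x \<in> A"; cases "x = a") (auto simp: PiE_def extensional_def)
      qed
      show "(\<lambda>h. restrict h (A - {a})) ` {h \<in> A \<rightarrow>\<^sub>E {1..m}. h a = h b} \<subseteq> (A - {a}) \<rightarrow>\<^sub>E {1..m}"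
        unfolding image_subset_iff restrict_PiE_iff by (auto simp: PiE_iff)
      show "finite ((A - {a}) \<rightarrow>\<^sub>E {1..m})"
        using assms by (intro finite_PiE) auto
    qed
    also have "\<dots> = m ^ (card A - 1)"
      using assms ab by (simp add: card_PiE)
    finally have "card {h \<in> A \<rightarrow>\<^sub>E {1..m}. h a = h b} \<le> m ^ (card A - 1)" .
    then have *: "real (card {h \<in> A \<rightarrow>\<^sub>E {1..m}. h a = h b}) \<le> real m ^ (card A - 1)"
      by (simp only: of_nat_le_iff flip: of_nat_power)
    have "card A = Suc (card A - 1)"
      using assms ab card_gt_0_iff[of A] by auto
    then have "real m ^ card A = real m * real m ^ (card A - 1)"
      using power_Suc[of "real m" "card A - 1"] by simp
    then show ?thesis
      using * assms by (simp add: card_PiE)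
  qed
  then show ?thesis
    using assms unfolding universal_hash_def by (auto intro: finite_PiE simp: PiE_eq_empty_iff)
qed

text \<open>The collision event of the pair is a product set. The decoders of \<open>W\<close>
  profit from both hashes jointly, while \<open>F\<close> alone has to be close to uniform.\<close>

lemma universal_hash_Times:
  assumes "universal_hash H hf A \<kappa>" and "universal_hash K kf A \<mu>" and "0 \<le> \<kappa>"
  shows "universal_hash (H \<times> K) (\<lambda>(h, k) a. (hf h a, kf k a)) A (\<kappa> * \<mu>)"
proof -
  have "real (card {p \<in> H \<times> K. (case p of (h, k) \<Rightarrow> \<lambda>a. (hf h a, kf k a)) a = (case p of (h, k) \<Rightarrow> \<lambda>a. (hf h a, kf k a)) b})
      \<le> \<kappa> * \<mu> * real (card (H \<times> K))" if "a \<in> A" "b \<in> A" "a \<noteq> b" for a b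
  proof -
    have eq: "{p \<in> H \<times> K. (case p of (h, k) \<Rightarrow> \<lambda>a. (hf h a, kf k a)) a = (case p of (h, k) \<Rightarrow> \<lambda>a. (hf h a, kf k a)) b}
      = {h\<in>H. hf h a = hf h b} \<times> {k\<in>K. kf k a = kf k b}" by auto
    have "real (card {h\<in>H. hf h a = hf h b}) * real (card {k\<in>K. kf k a = kf k b})
        \<le> (\<kappa> * real (card H)) * (\<mu> * real (card K))"
      using assms that unfolding universal_hash_def by (intro mult_mono) auto
    then show ?thesis
      unfolding eq card_cartesian_product by (simp add: algebra_simps)
  qed
  then show ?thesis
    using assms(1,2) unfolding universal_hash_def by auto
qed

lemma sum_over_fibers:
  fixes g :: "'a \<Rightarrow> real"
  assumes "finite A" and "finite B" and "h ` A \<subseteq> B"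
  shows "(\<Sum>b\<in>B. \<Sum>a\<in>{a\<in>A. h a = b}. g a) = (\<Sum>a\<in>A. g a)"
  using sum.group[OF assms, of g] by simp

text \<open>Expanding the square gives a sum over pairs (a, b) weighted by the number of keys under
  which they collide. Off the diagonal universality bounds that number by \<open>card H / m\<close>;
  on the diagonal it is all of \<open>card H\<close>, which accounts for the correction by the sum
  of squares.\<close>

lemma sum_squares_hash_bins:
  fixes q :: "'a \<Rightarrow> real"
  assumes uni: "universal_hash H hf A (1 / real m)" and A: "finite A" and m: "1 \<le> m"
    and ran: "\<And>h a. h \<in> H \<Longrightarrow> a \<in> A \<Longrightarrow> hf h a \<in> {1..m}"
    and q: "\<And>a. a \<in> A \<Longrightarrow> 0 \<le> q a"
  shows "(\<Sum>h\<in>H. \<Sum>f\<in>{1..m}. (\<Sum>a\<in>{a\<in>A. hf h a = f}. q a)\<^sup>2)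
    \<le> real (card H) * ((\<Sum>a\<in>A. (q a)\<^sup>2) + ((\<Sum>a\<in>A. q a)\<^sup>2 - (\<Sum>a\<in>A. (q a)\<^sup>2)) / real m)"
proof -
  have finH: "finite H" using uni by (simp add: universal_hash_def)
  have bins: "(\<Sum>f\<in>{1..m}. (\<Sum>a\<in>{a\<in>A. hf h a = f}. q a)\<^sup>2)
      = (\<Sum>a\<in>A. \<Sum>b\<in>A. q a * q b * (if hf h a = hf h b then 1 else 0))" if h: "h \<in> H" for h
  proof -
    have "(\<Sum>f\<in>{1..m}. (\<Sum>a\<in>{a\<in>A. hf h a = f}. q a)\<^sup>2)
        = (\<Sum>f\<in>{1..m}. \<Sum>a\<in>{a\<in>A. hf h a = f}. q a * (\<Sum>b\<in>{b\<in>A. hf h b = hf h a}. q b))"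
      by (auto simp: power2_eq_square sum_distrib_right intro!: sum.cong)
    also have "\<dots> = (\<Sum>a\<in>A. q a * (\<Sum>b\<in>{b\<in>A. hf h b = hf h a}. q b))"
      using ran h by (intro sum_over_fibers) (use A in auto)
    also have "\<dots> = (\<Sum>a\<in>A. \<Sum>b\<in>A. q a * q b * (if hf h a = hf h b then 1 else 0))"
      by (intro sum.cong refl) (simp add: sum.inter_filter[OF A] sum_distrib_left eq_commute if_distrib cong: if_cong)
    finally show ?thesis .
  qed
  have "(\<Sum>h\<in>H. \<Sum>f\<in>{1..m}. (\<Sum>a\<in>{a\<in>A. hf h a = f}. q a)\<^sup>2)
      = (\<Sum>h\<in>H. \<Sum>a\<in>A. \<Sum>b\<in>A. q a * q b * (if hf h a = hf h b then 1 else 0))"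
    using bins by simp
  also have "\<dots> = (\<Sum>a\<in>A. \<Sum>h\<in>H. \<Sum>b\<in>A. q a * q b * (if hf h a = hf h b then 1 else 0))"
    by (rule sum.swap)
  also have "\<dots> = (\<Sum>a\<in>A. \<Sum>b\<in>A. \<Sum>h\<in>H. q a * q b * (if hf h a = hf h b then 1 else 0))"
    by (intro sum.cong refl sum.swap)
  also have "\<dots> = (\<Sum>a\<in>A. \<Sum>b\<in>A. q a * q b * real (card {h\<in>H. hf h a = hf h b}))"
    by (simp add: sum_distrib_left[symmetric] sum.inter_filter[OF finH, symmetric])
  also have "\<dots> \<le> (\<Sum>a\<in>A. \<Sum>b\<in>A. real (card H) * (q a * q b / real m
        + (if a = b then (q a)\<^sup>2 * (1 - 1 / real m) else 0)))"
  proof (intro sum_mono)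
    fix a b assume ab: "a \<in> A" "b \<in> A"
    show "q a * q b * real (card {h\<in>H. hf h a = hf h b})
      \<le> real (card H) * (q a * q b / real m + (if a = b then (q a)\<^sup>2 * (1 - 1 / real m) else 0))"
    proof (cases "a = b")
      case True
      then show ?thesis by (simp add: power2_eq_square algebra_simps)
    next
      case False
      then have "q a * q b * real (card {h\<in>H. hf h a = hf h b}) \<le> q a * q b * (1 / real m * real (card H))"
        using uni ab q unfolding universal_hash_def by (intro mult_left_mono) auto
      then show ?thesis using False by (simp add: algebra_simps)
    qed
  qed
  also have "\<dots> = real (card H) * ((\<Sum>a\<in>A. \<Sum>b\<in>A. q a * q b) / real m + (\<Sum>a\<in>A. (q a)\<^sup>2) * (1 - 1 / real m))"
    using A by (simp add: sum_distrib_left[symmetric] sum.distrib sum_divide_distrib[symmetric] sum_distrib_right[symmetric])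
  also have "\<dots> = real (card H) * ((\<Sum>a\<in>A. (q a)\<^sup>2) + ((\<Sum>a\<in>A. q a)\<^sup>2 - (\<Sum>a\<in>A. (q a)\<^sup>2)) / real m)"
    by (simp add: power2_eq_square sum_product algebra_simps diff_divide_distrib)
  finally show ?thesis .
qed

text \<open>Points heavier than \<tau> are deleted, and the bins of the remaining q have a small
  variance because the sum of the squares of q is at most \<tau>. The deleted mass t enters twice:
  once as mass missing from the bins and once through the shift of the mean from
  \<open>1 / m\<close> to \<open>(1 - t) / m\<close>. The factor is \<open>m - 1\<close> rather than
  m so that a single bin gives deviation 0 for every \<tau>.\<close>

lemma leftover_hash:
  fixes r :: "'a \<Rightarrow> real"
  assumes uni: "universal_hash H hf A (1 / real m)" and A: "finite A" and m: "1 \<le> m"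
    and ran: "\<And>h a. h \<in> H \<Longrightarrow> a \<in> A \<Longrightarrow> hf h a \<in> {1..m}"
    and r: "\<And>a. a \<in> A \<Longrightarrow> 0 \<le> r a" and r1: "(\<Sum>a\<in>A. r a) = 1" and \<tau>: "0 \<le> \<tau>"
  shows "(\<Sum>h\<in>H. \<Sum>f\<in>{1..m}. \<bar>(\<Sum>a\<in>{a\<in>A. hf h a = f}. r a) - 1 / real m\<bar>)
    \<le> real (card H) * (2 * (\<Sum>a\<in>{a\<in>A. \<tau> < r a}. r a) + sqrt ((real m - 1) * \<tau>))"
proof -
  have finH: "finite H" using uni by (simp add: universal_hash_def)
  define q where "q a = (if \<tau> < r a then 0 else r a)" for a
  define d where "d h f = (\<Sum>a\<in>{a\<in>A. hf h a = f}. q a) - (\<Sum>a\<in>A. q a) / real m" for h f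
  define t where "t = (\<Sum>a\<in>{a\<in>A. \<tau> < r a}. r a)"
  let ?s = "\<Sum>a\<in>A. q a"
  have q: "0 \<le> q a" "q a \<le> \<tau>" if "a \<in> A" for a using r that \<tau> by (auto simp: q_def)
  have rq: "(\<Sum>a\<in>{a\<in>A. P a}. r a) = (\<Sum>a\<in>{a\<in>A. P a}. q a) + (\<Sum>a\<in>{a\<in>A. P a}. r a - q a)" for P
    by (simp add: sum_subtractf)
  have t: "(\<Sum>a\<in>A. r a - q a) = t"
    unfolding t_def q_def sum.inter_filter[OF A] by (intro sum.cong) auto
  have s: "?s = 1 - t" using t r1 by (simp add: sum_subtractf)
  have s0: "0 \<le> ?s" using q by (intro sum_nonneg) auto
  have t0: "0 \<le> t" unfolding t_def using r by (intro sum_nonneg) auto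
  have sumbins: "(\<Sum>f\<in>{1..m}. \<Sum>a\<in>{a\<in>A. hf h a = f}. g a) = (\<Sum>a\<in>A. g a)" if "h \<in> H" for h and g :: "'a \<Rightarrow> real"
    using ran that by (intro sum_over_fibers) (use A in auto)
  have bin: "(\<Sum>f\<in>{1..m}. \<bar>(\<Sum>a\<in>{a\<in>A. hf h a = f}. r a) - 1 / real m\<bar>) \<le> (\<Sum>f\<in>{1..m}. \<bar>d h f\<bar>) + 2 * t"
    if h: "h \<in> H" for h
  proof -
    have "(\<Sum>f\<in>{1..m}. \<bar>(\<Sum>a\<in>{a\<in>A. hf h a = f}. r a) - 1 / real m\<bar>)
        \<le> (\<Sum>f\<in>{1..m}. \<bar>d h f\<bar> + (\<Sum>a\<in>{a\<in>A. hf h a = f}. r a - q a) + t / real m)"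
    proof (rule sum_mono)
      fix f
      have "0 \<le> (\<Sum>a\<in>{a\<in>A. hf h a = f}. r a - q a)"
        using r by (intro sum_nonneg) (auto simp: q_def)
      moreover have "0 \<le> t / real m" using t0 by simp
      moreover have "(\<Sum>a\<in>{a\<in>A. hf h a = f}. r a) - 1 / real m
          = d h f + (\<Sum>a\<in>{a\<in>A. hf h a = f}. r a - q a) - t / real m"
        unfolding d_def s by (simp add: sum_subtractf diff_divide_distrib)
      ultimately show "\<bar>(\<Sum>a\<in>{a\<in>A. hf h a = f}. r a) - 1 / real m\<bar>
          \<le> \<bar>d h f\<bar> + (\<Sum>a\<in>{a\<in>A. hf h a = f}. r a - q a) + t / real m" by linarith
    qed
    also have "\<dots> = (\<Sum>f\<in>{1..m}. \<bar>d h f\<bar>) + 2 * t"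
      using sumbins[OF h, of "\<lambda>a. r a - q a"] t m by (simp add: sum.distrib)
    finally show ?thesis .
  qed
  have dsq: "(\<Sum>f\<in>{1..m}. (d h f)\<^sup>2) = (\<Sum>f\<in>{1..m}. (\<Sum>a\<in>{a\<in>A. hf h a = f}. q a)\<^sup>2) - ?s\<^sup>2 / real m"
    if h: "h \<in> H" for h
  proof -
    have "(\<Sum>f\<in>{1..m}. (d h f)\<^sup>2) = (\<Sum>f\<in>{1..m}. (\<Sum>a\<in>{a\<in>A. hf h a = f}. q a)\<^sup>2)
        - 2 * (?s / real m) * (\<Sum>f\<in>{1..m}. \<Sum>a\<in>{a\<in>A. hf h a = f}. q a) + real m * (?s / real m)\<^sup>2"
      unfolding d_def by (simp add: power2_diff sum.distrib sum_subtractf sum_distrib_left sum_distrib_right mult_ac)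
    also have "\<dots> = (\<Sum>f\<in>{1..m}. (\<Sum>a\<in>{a\<in>A. hf h a = f}. q a)\<^sup>2) - ?s\<^sup>2 / real m"
      unfolding sumbins[OF h] using m by (simp add: power2_eq_square field_simps)
    finally show ?thesis .
  qed
  have "(\<Sum>a\<in>A. (q a)\<^sup>2) \<le> (\<Sum>a\<in>A. \<tau> * q a)"
    using q by (intro sum_mono) (simp add: power2_eq_square mult_right_mono)
  also have "\<dots> \<le> \<tau>" using s s0 t0 \<tau> by (simp add: sum_distrib_left[symmetric] mult_left_le)
  finally have q2: "(\<Sum>a\<in>A. (q a)\<^sup>2) \<le> \<tau>" .
  have "(\<Sum>h\<in>H. \<Sum>f\<in>{1..m}. (d h f)\<^sup>2)
      = (\<Sum>h\<in>H. \<Sum>f\<in>{1..m}. (\<Sum>a\<in>{a\<in>A. hf h a = f}. q a)\<^sup>2) - real (card H) * (?s\<^sup>2 / real m)"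
    using dsq by (simp add: sum_subtractf)
  also have "\<dots> \<le> real (card H) * ((\<Sum>a\<in>A. (q a)\<^sup>2) + (?s\<^sup>2 - (\<Sum>a\<in>A. (q a)\<^sup>2)) / real m) - real (card H) * (?s\<^sup>2 / real m)"
    using sum_squares_hash_bins[OF uni A m ran q(1)] by simp
  also have "\<dots> = real (card H) * ((\<Sum>a\<in>A. (q a)\<^sup>2) * ((real m - 1) / real m))"
    using m by (simp add: field_simps)
  also have "\<dots> \<le> real (card H) * (\<tau> * ((real m - 1) / real m))"
    using q2 m by (intro mult_left_mono mult_right_mono) auto
  finally have D2: "(\<Sum>h\<in>H. \<Sum>f\<in>{1..m}. (d h f)\<^sup>2) \<le> real (card H) * (\<tau> * ((real m - 1) / real m))" .
  \<comment> \<open>Cauchy-Schwarz over all pairs of a key and a bin; the number m of bins cancels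
    the denominator of the variance bound.\<close>
  have "(\<Sum>h\<in>H. \<Sum>f\<in>{1..m}. \<bar>d h f\<bar>)\<^sup>2 = (\<Sum>p\<in>H \<times> {1..m}. \<bar>d (fst p) (snd p)\<bar>)\<^sup>2"
    by (simp add: sum.cartesian_product case_prod_unfold)
  also have "\<dots> \<le> real (card (H \<times> {1..m})) * (\<Sum>p\<in>H \<times> {1..m}. \<bar>d (fst p) (snd p)\<bar>\<^sup>2)"
    using sum_squared_le_sum_of_squares[of "\<lambda>p. \<bar>d (fst p) (snd p)\<bar>" "H \<times> {1..m}"] finH by (simp add: mult.commute)
  also have "\<dots> = real (card H) * real m * (\<Sum>h\<in>H. \<Sum>f\<in>{1..m}. (d h f)\<^sup>2)"
    by (simp add: sum.cartesian_product case_prod_unfold card_cartesian_product)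
  also have "\<dots> \<le> real (card H) * real m * (real (card H) * (\<tau> * ((real m - 1) / real m)))"
    using D2 by (intro mult_left_mono) auto
  also have "\<dots> = (real (card H))\<^sup>2 * ((real m - 1) * \<tau>)"
    using m by (simp add: power2_eq_square field_simps)
  finally have "(\<Sum>h\<in>H. \<Sum>f\<in>{1..m}. \<bar>d h f\<bar>) \<le> sqrt ((real (card H))\<^sup>2 * ((real m - 1) * \<tau>))"
    by (rule real_le_rsqrt)
  then have D: "(\<Sum>h\<in>H. \<Sum>f\<in>{1..m}. \<bar>d h f\<bar>) \<le> real (card H) * sqrt ((real m - 1) * \<tau>)"
    by (simp add: real_sqrt_mult)
  have "(\<Sum>h\<in>H. \<Sum>f\<in>{1..m}. \<bar>(\<Sum>a\<in>{a\<in>A. hf h a = f}. r a) - 1 / real m\<bar>)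
      \<le> (\<Sum>h\<in>H. (\<Sum>f\<in>{1..m}. \<bar>d h f\<bar>) + 2 * t)"
    using bin by (rule sum_mono)
  also have "\<dots> \<le> real (card H) * (2 * t + sqrt ((real m - 1) * \<tau>))"
    using D by (simp add: sum.distrib algebra_simps)
  finally show ?thesis unfolding t_def .
qed

section \<open>Decoding from a hash and side information\<close>

text \<open>Covers both ways in which decoding can fail: the true pair lies outside T, or a second
  candidate shares its hash. In the complementary case the candidate is unique, so the choice
  operator in \<open>bin_decoder\<close> returns it.\<close>

definition collides :: "('a \<Rightarrow> 'b) \<Rightarrow> ('a \<times> 's) set \<Rightarrow> 'a set \<Rightarrow> 'a \<Rightarrow> 's \<Rightarrow> bool" where
  "collides h T A a s \<longleftrightarrow> (a, s) \<notin> T \<or> (\<exists>a'\<in>A. a' \<noteq> a \<and> h a' = h a \<and> (a', s) \<in> T)"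

definition bin_decoder :: "('a \<Rightarrow> 'b) \<Rightarrow> ('a \<times> 's) set \<Rightarrow> 'a set \<Rightarrow> 'b \<Rightarrow> 's \<Rightarrow> 'a" where
  "bin_decoder h T A k s = (SOME a. a \<in> A \<and> h a = k \<and> (a, s) \<in> T)"

lemma bin_decoder_eq:
  assumes "a \<in> A" and "\<not> collides h T A a s"
  shows "bin_decoder h T A (h a) s = a"
  unfolding bin_decoder_def using assms by (intro some_equality) (auto simp: collides_def)

text \<open>A union bound over the competitors in the slice of T above the side information. Each of
  them shares the hash of the true value for at most a fraction \<kappa> of the keys.\<close>

lemma average_collision:
  fixes p :: "'o \<Rightarrow> real"
  assumes uni: "universal_hash H hf A \<kappa>" and \<Omega>: "finite \<Omega>" and A: "finite A"
    and p: "\<And>\<omega>. \<omega> \<in> \<Omega> \<Longrightarrow> 0 \<le> p \<omega>" and X: "\<And>\<omega>. \<omega> \<in> \<Omega> \<Longrightarrow> X \<omega> \<in> A" and \<kappa>: "0 \<le> \<kappa>"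
  shows "(\<Sum>h\<in>H. \<Sum>\<omega>\<in>{\<omega>\<in>\<Omega>. collides (hf h) T A (X \<omega>) (S \<omega>)}. p \<omega>)
    \<le> real (card H) * ((\<Sum>\<omega>\<in>{\<omega>\<in>\<Omega>. (X \<omega>, S \<omega>) \<notin> T}. p \<omega>)
        + \<kappa> * (\<Sum>\<omega>\<in>\<Omega>. p \<omega> * real (card {a\<in>A. (a, S \<omega>) \<in> T})))"
proof -
  have finH: "finite H" using uni by (simp add: universal_hash_def)
  have "(\<Sum>h\<in>H. \<Sum>\<omega>\<in>{\<omega>\<in>\<Omega>. collides (hf h) T A (X \<omega>) (S \<omega>)}. p \<omega>)
      = (\<Sum>h\<in>H. \<Sum>\<omega>\<in>\<Omega>. if collides (hf h) T A (X \<omega>) (S \<omega>) then p \<omega> else 0)"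
    using \<Omega> by (simp add: sum.inter_filter)
  also have "\<dots> = (\<Sum>\<omega>\<in>\<Omega>. \<Sum>h\<in>H. if collides (hf h) T A (X \<omega>) (S \<omega>) then p \<omega> else 0)"
    by (rule sum.swap)
  also have "\<dots> \<le> (\<Sum>\<omega>\<in>\<Omega>. real (card H) * ((if (X \<omega>, S \<omega>) \<notin> T then p \<omega> else 0)
      + \<kappa> * (p \<omega> * real (card {a\<in>A. (a, S \<omega>) \<in> T}))))"
  proof (rule sum_mono)
    fix \<omega> assume \<omega>: "\<omega> \<in> \<Omega>"
    have "(\<Sum>h\<in>H. if collides (hf h) T A (X \<omega>) (S \<omega>) then p \<omega> else 0)
        \<le> (\<Sum>h\<in>H. (if (X \<omega>, S \<omega>) \<notin> T then p \<omega> else 0)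
            + (\<Sum>a\<in>{a\<in>A. (a, S \<omega>) \<in> T}. if a \<noteq> X \<omega> \<and> hf h a = hf h (X \<omega>) then p \<omega> else 0))"
    proof (rule sum_mono)
      fix h
      let ?g = "\<lambda>a. if a \<noteq> X \<omega> \<and> hf h a = hf h (X \<omega>) then p \<omega> else 0"
      have nn: "0 \<le> (\<Sum>a\<in>{a\<in>A. (a, S \<omega>) \<in> T}. ?g a)" using p[OF \<omega>] by (intro sum_nonneg) auto
      have "p \<omega> \<le> (\<Sum>a\<in>{a\<in>A. (a, S \<omega>) \<in> T}. ?g a)"
        if a: "a \<in> A" "(a, S \<omega>) \<in> T" "a \<noteq> X \<omega>" "hf h a = hf h (X \<omega>)" for a
        using member_le_sum[of a "{a\<in>A. (a, S \<omega>) \<in> T}" ?g] a A p[OF \<omega>] by auto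
      then show "(if collides (hf h) T A (X \<omega>) (S \<omega>) then p \<omega> else 0)
          \<le> (if (X \<omega>, S \<omega>) \<notin> T then p \<omega> else 0) + (\<Sum>a\<in>{a\<in>A. (a, S \<omega>) \<in> T}. ?g a)"
        using nn p[OF \<omega>] unfolding collides_def by fastforce
    qed
    also have "\<dots> = real (card H) * (if (X \<omega>, S \<omega>) \<notin> T then p \<omega> else 0)
        + (\<Sum>a\<in>{a\<in>A. (a, S \<omega>) \<in> T}. \<Sum>h\<in>H. if a \<noteq> X \<omega> \<and> hf h a = hf h (X \<omega>) then p \<omega> else 0)"
      unfolding sum.distrib by (subst sum.swap) simp
    also have "\<dots> \<le> real (card H) * (if (X \<omega>, S \<omega>) \<notin> T then p \<omega> else 0)
        + (\<Sum>a\<in>{a\<in>A. (a, S \<omega>) \<in> T}. p \<omega> * (\<kappa> * real (card H)))"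
    proof (intro add_left_mono sum_mono)
      fix a assume a: "a \<in> {a\<in>A. (a, S \<omega>) \<in> T}"
      show "(\<Sum>h\<in>H. if a \<noteq> X \<omega> \<and> hf h a = hf h (X \<omega>) then p \<omega> else 0) \<le> p \<omega> * (\<kappa> * real (card H))"
      proof (cases "a = X \<omega>")
        case True then show ?thesis using p[OF \<omega>] \<kappa> by simp
      next
        case False
        then have "real (card {h\<in>H. hf h a = hf h (X \<omega>)}) \<le> \<kappa> * real (card H)"
          using uni a X[OF \<omega>] unfolding universal_hash_def by auto
        then show ?thesis
          using False p[OF \<omega>] by (simp add: sum.inter_filter[OF finH, symmetric] mult.commute mult_left_mono)
      qed
    qed
    also have "\<dots> = real (card H) * ((if (X \<omega>, S \<omega>) \<notin> T then p \<omega> else 0)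
      + \<kappa> * (p \<omega> * real (card {a\<in>A. (a, S \<omega>) \<in> T})))"
      by (simp add: algebra_simps)
    finally show "(\<Sum>h\<in>H. if collides (hf h) T A (X \<omega>) (S \<omega>) then p \<omega> else 0)
      \<le> real (card H) * ((if (X \<omega>, S \<omega>) \<notin> T then p \<omega> else 0)
      + \<kappa> * (p \<omega> * real (card {a\<in>A. (a, S \<omega>) \<in> T})))" .
  qed
  also have "\<dots> = real (card H) * ((\<Sum>\<omega>\<in>{\<omega>\<in>\<Omega>. (X \<omega>, S \<omega>) \<notin> T}. p \<omega>)
        + \<kappa> * (\<Sum>\<omega>\<in>\<Omega>. p \<omega> * real (card {a\<in>A. (a, S \<omega>) \<in> T})))"
    using \<Omega> by (simp add: sum_distrib_left[symmetric] sum.distrib sum.inter_filter)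
  finally show ?thesis .
qed

lemma exists_le_average:
  fixes g :: "'h \<Rightarrow> real"
  assumes "finite H" and "H \<noteq> {}" and "(\<Sum>h\<in>H. g h) \<le> real (card H) * b"
  shows "\<exists>h\<in>H. g h \<le> b"
proof (rule ccontr)
  assume "\<not> ?thesis"
  then have "(\<Sum>h\<in>H. b) < (\<Sum>h\<in>H. g h)" using assms by (intro sum_strict_mono) auto
  then show False using assms by simp
qed

text \<open>Here \<open>F\<close> stands for randomness shared by encoder and decoders. Under the ideal law \<open>w\<close>
  is drawn from the kernel and \<open>f = F w\<close>; since \<open>f\<close> is then almost uniform and independent of the
  source, some constant \<open>f\<close> is as good, and the best \<open>w\<close> for this \<open>f\<close> does at least as well
  as a random one.\<close>

lemma fix_shared_randomness:
  fixes q :: "'o \<Rightarrow> real" and c :: "'z \<Rightarrow> 'w \<Rightarrow> real" and Z :: "'o \<Rightarrow> 'z" and F :: "'w \<Rightarrow> nat"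
    and cost :: "'w \<Rightarrow> nat \<Rightarrow> 'o \<Rightarrow> real"
  assumes \<Omega>: "finite \<Omega>" and A: "finite A" "A \<noteq> {}" and m: "1 \<le> m"
    and q: "\<And>\<omega>. \<omega> \<in> \<Omega> \<Longrightarrow> 0 \<le> q \<omega>"
    and c: "\<And>z w. 0 \<le> c z w"
    and F: "\<And>w. w \<in> A \<Longrightarrow> F w \<in> {1..m}"
    and cost: "\<And>w f \<omega>. 0 \<le> cost w f \<omega>" "\<And>w f \<omega>. cost w f \<omega> \<le> 2"
  shows "\<exists>f enc. (\<forall>z. enc z \<in> A) \<and> (\<Sum>\<omega>\<in>\<Omega>. q \<omega> * cost (enc (Z \<omega>)) f \<omega>)
    \<le> (\<Sum>\<omega>\<in>\<Omega>. \<Sum>w\<in>A. q \<omega> * c (Z \<omega>) w * cost w (F w) \<omega>)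
      + 2 * (\<Sum>\<omega>\<in>\<Omega>. q \<omega> * (\<Sum>f\<in>{1..m}. \<bar>(\<Sum>w\<in>{w\<in>A. F w = f}. c (Z \<omega>) w) - 1 / real m\<bar>))"
    (is "\<exists>f enc. _ \<and> _ \<le> ?ideal + 2 * ?D")
proof -
  \<comment> \<open>The encoder sees only z, so a candidate w is judged by its cost summed over all
    outcomes with this z. The minimum is taken over the whole of A and not over the bin of f, so
    empty bins need no separate case.\<close>
  define e where "e w z f = (\<Sum>\<omega>\<in>{\<omega>\<in>\<Omega>. Z \<omega> = z}. q \<omega> * cost w f \<omega>)" for w z f
  have "\<exists>w. w \<in> A \<and> (\<forall>w'\<in>A. e w z f \<le> e w' z f)" for z f
    using ex_min_if_finite[of "(\<lambda>w. e w z f) ` A"] A by (force simp: not_less)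
  then obtain enc where enc: "\<And>z f. enc z f \<in> A" "\<And>z f w. w \<in> A \<Longrightarrow> e (enc z f) z f \<le> e w z f"
    by metis
  define C where "C z f = (\<Sum>w\<in>{w\<in>A. F w = f}. c z w)" for z f
  have grp: "(\<Sum>z\<in>Z ` \<Omega>. \<Sum>\<omega>\<in>{\<omega>\<in>\<Omega>. Z \<omega> = z}. g \<omega>) = (\<Sum>\<omega>\<in>\<Omega>. g \<omega>)" for g :: "'o \<Rightarrow> real"
    using \<Omega> by (intro sum_over_fibers) auto
  have "(\<Sum>f\<in>{1..m}. \<Sum>\<omega>\<in>\<Omega>. q \<omega> * cost (enc (Z \<omega>) f) f \<omega>) * (1 / real m)
      = (\<Sum>\<omega>\<in>\<Omega>. \<Sum>f\<in>{1..m}. q \<omega> * cost (enc (Z \<omega>) f) f \<omega> * (1 / real m))"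
    by (subst sum.swap) (simp add: sum_distrib_right sum_divide_distrib)
  \<comment> \<open>Change of measure on f from the uniform law to the law of \<open>F\<close> under
    the kernel. Each unit of discrepancy costs at most 2, the upper bound on
    \<open>cost\<close>.\<close>
  also have "\<dots> \<le> (\<Sum>\<omega>\<in>\<Omega>. \<Sum>f\<in>{1..m}. C (Z \<omega>) f * (q \<omega> * cost (enc (Z \<omega>) f) f \<omega>)
      + 2 * (q \<omega> * \<bar>C (Z \<omega>) f - 1 / real m\<bar>))"
  proof (intro sum_mono)
    fix \<omega> f assume \<omega>: "\<omega> \<in> \<Omega>"
    let ?k = "q \<omega> * cost (enc (Z \<omega>) f) f \<omega>"
    have "?k * (1 / real m) \<le> ?k * (C (Z \<omega>) f + \<bar>C (Z \<omega>) f - 1 / real m\<bar>)"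
      using q[OF \<omega>] cost by (intro mult_left_mono mult_nonneg_nonneg) auto
    moreover have "?k * \<bar>C (Z \<omega>) f - 1 / real m\<bar> \<le> q \<omega> * 2 * \<bar>C (Z \<omega>) f - 1 / real m\<bar>"
      using q[OF \<omega>] cost by (intro mult_right_mono mult_left_mono) auto
    ultimately show "?k * (1 / real m) \<le> C (Z \<omega>) f * ?k + 2 * (q \<omega> * \<bar>C (Z \<omega>) f - 1 / real m\<bar>)"
      by (simp add: algebra_simps)
  qed
  also have "\<dots> = (\<Sum>\<omega>\<in>\<Omega>. \<Sum>f\<in>{1..m}. C (Z \<omega>) f * (q \<omega> * cost (enc (Z \<omega>) f) f \<omega>)) + 2 * ?D"
    by (simp add: sum.distrib sum_distrib_left C_def)
  also have "(\<Sum>\<omega>\<in>\<Omega>. \<Sum>f\<in>{1..m}. C (Z \<omega>) f * (q \<omega> * cost (enc (Z \<omega>) f) f \<omega>))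
      = (\<Sum>\<omega>\<in>\<Omega>. \<Sum>w\<in>A. c (Z \<omega>) w * (q \<omega> * cost (enc (Z \<omega>) (F w)) (F w) \<omega>))"
  proof (rule sum.cong[OF refl])
    fix \<omega>
    have "(\<Sum>f\<in>{1..m}. C (Z \<omega>) f * (q \<omega> * cost (enc (Z \<omega>) f) f \<omega>))
        = (\<Sum>f\<in>{1..m}. \<Sum>w\<in>{w\<in>A. F w = f}. c (Z \<omega>) w * (q \<omega> * cost (enc (Z \<omega>) (F w)) (F w) \<omega>))"
      unfolding C_def by (intro sum.cong refl) (simp add: sum_distrib_right)
    also have "\<dots> = (\<Sum>w\<in>A. c (Z \<omega>) w * (q \<omega> * cost (enc (Z \<omega>) (F w)) (F w) \<omega>))"
      using F A by (intro sum_over_fibers) auto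
    finally show "(\<Sum>f\<in>{1..m}. C (Z \<omega>) f * (q \<omega> * cost (enc (Z \<omega>) f) f \<omega>))
        = (\<Sum>w\<in>A. c (Z \<omega>) w * (q \<omega> * cost (enc (Z \<omega>) (F w)) (F w) \<omega>))" .
  qed
  also have "\<dots> = (\<Sum>w\<in>A. \<Sum>\<omega>\<in>\<Omega>. c (Z \<omega>) w * (q \<omega> * cost (enc (Z \<omega>) (F w)) (F w) \<omega>))"
    by (rule sum.swap)
  also have "\<dots> = (\<Sum>w\<in>A. \<Sum>z\<in>Z ` \<Omega>. c z w * e (enc z (F w)) z (F w))"
    by (intro sum.cong refl) (simp add: grp[symmetric] e_def sum_distrib_left)
  \<comment> \<open>Optimality of \<open>enc z f\<close> at \<open>f = F w\<close>, tested against w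
    itself.\<close>
  also have "\<dots> \<le> (\<Sum>w\<in>A. \<Sum>z\<in>Z ` \<Omega>. c z w * e w z (F w))"
    using enc c by (intro sum_mono mult_left_mono) auto
  also have "\<dots> = (\<Sum>w\<in>A. \<Sum>\<omega>\<in>\<Omega>. c (Z \<omega>) w * (q \<omega> * cost w (F w) \<omega>))"
    by (intro sum.cong refl) (simp add: grp[symmetric] e_def sum_distrib_left)
  also have "\<dots> = ?ideal"
    by (subst sum.swap) (simp add: mult_ac)
  finally have "(\<Sum>f\<in>{1..m}. \<Sum>\<omega>\<in>\<Omega>. q \<omega> * cost (enc (Z \<omega>) f) f \<omega>) * (1 / real m) \<le> ?ideal + 2 * ?D"
    by simp
  then have "(\<Sum>f\<in>{1..m}. \<Sum>\<omega>\<in>\<Omega>. q \<omega> * cost (enc (Z \<omega>) f) f \<omega>) \<le> real (card {1..m}) * (?ideal + 2 * ?D)"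
    using m by (simp add: field_simps)
  then have "\<exists>f\<in>{1..m}. (\<Sum>\<omega>\<in>\<Omega>. q \<omega> * cost (enc (Z \<omega>) f) f \<omega>) \<le> ?ideal + 2 * ?D"
    using m by (intro exists_le_average) simp_all
  then obtain f where f: "(\<Sum>\<omega>\<in>\<Omega>. q \<omega> * cost (enc (Z \<omega>) f) f \<omega>) \<le> ?ideal + 2 * ?D" ..
  show ?thesis
    by (rule exI[of _ f], rule exI[of _ "\<lambda>z. enc z f"]) (use enc(1) f in simp)
qed

section \<open>Entropy and typicality of i.i.d. blocks\<close>

abbreviation blocks :: "nat \<Rightarrow> 'a list set" where
  "blocks n \<equiv> {xs. length xs = n}"

definition marg :: "('o::finite \<Rightarrow> real) \<Rightarrow> ('o \<Rightarrow> 'a) \<Rightarrow> 'a \<Rightarrow> real" where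
  "marg p f a = (\<Sum>\<omega>\<in>{\<omega>. f \<omega> = a}. p \<omega>)"

text \<open>The letter weights are arbitrary reals: besides probability functions and their
  marginals, the kernel c is used, which does not sum to 1 over triples (w, x, y).\<close>

definition iid_weight :: "('o \<Rightarrow> real) \<Rightarrow> 'o list \<Rightarrow> real" where
  "iid_weight p xs = prod_list (map p xs)"

lemma iid_weight_simps [simp]:
  "iid_weight p [] = 1" "iid_weight p (x # xs) = p x * iid_weight p xs"
  by (simp_all add: iid_weight_def)

lemma iid_weight_map: "iid_weight p (map f xs) = iid_weight (\<lambda>x. p (f x)) xs"
  by (simp add: iid_weight_def comp_def)

lemma iid_weight_nonneg: "(\<And>x. 0 \<le> p x) \<Longrightarrow> 0 \<le> iid_weight p xs"
  by (induction xs) auto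

lemma iid_weight_pos: "(\<And>x. x \<in> set xs \<Longrightarrow> 0 < p x) \<Longrightarrow> 0 < iid_weight p xs"
  by (induction xs) auto

lemma iid_weight_eq_0_iff: "iid_weight p xs = 0 \<longleftrightarrow> (\<exists>x\<in>set xs. p x = 0)"
  by (induction xs) auto

lemma log_iid_weight:
  "(\<And>x. x \<in> set xs \<Longrightarrow> 0 < p x) \<Longrightarrow> log 2 (iid_weight p xs) = (\<Sum>x\<leftarrow>xs. log 2 (p x))"
proof (induction xs)
  case (Cons x xs)
  then have "0 < p x" "0 < iid_weight p xs" "log 2 (iid_weight p xs) = (\<Sum>x\<leftarrow>xs. log 2 (p x))"
    by (auto intro: iid_weight_pos)
  then show ?case by (simp add: log_mult)
qed simp

lemma finite_blocks [simp]: "finite (blocks n :: 'a::finite list set)"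
  using finite_lists_length_eq[of "UNIV :: 'a set" n] by simp

lemma sum_blocks_Suc:
  fixes g :: "'a::finite list \<Rightarrow> real"
  shows "(\<Sum>xs\<in>blocks (Suc n). g xs) = (\<Sum>x\<in>UNIV. \<Sum>xs\<in>blocks n. g (x # xs))"
proof -
  have "(\<Sum>xs\<in>blocks (Suc n). g xs) = (\<Sum>(x, xs)\<in>UNIV \<times> blocks n. g (x # xs))"
    by (rule sum.reindex_bij_witness[where i = "\<lambda>(x, xs). x # xs" and j = "\<lambda>xs. (hd xs, tl xs)"])
      (auto simp: length_Suc_conv)
  then show ?thesis by (simp add: sum.cartesian_product)
qed

lemma sum_blocks_zip:
  fixes g :: "('a::finite \<times> 'b::finite) list \<Rightarrow> real"
  shows "(\<Sum>js\<in>blocks n. g js) = (\<Sum>bs\<in>blocks n. \<Sum>as\<in>blocks n. g (zip as bs))"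
proof -
  have "(\<Sum>js\<in>blocks n. g js) = (\<Sum>(bs, as)\<in>blocks n \<times> blocks n. g (zip as bs))"
    by (rule sum.reindex_bij_witness[where i = "\<lambda>(bs, as). zip as bs" and j = "\<lambda>js. (map snd js, map fst js)"])
      (auto simp: zip_map_fst_snd)
  then show ?thesis by (simp add: sum.cartesian_product)
qed

lemma sum_iid_weight:
  fixes p :: "'o::finite \<Rightarrow> real"
  shows "(\<Sum>xs\<in>blocks n. iid_weight p xs) = (\<Sum>x\<in>UNIV. p x) ^ n"
  by (induction n) (simp_all add: sum_blocks_Suc sum_distrib_left[symmetric] sum_distrib_right[symmetric])

lemma marg_iid_weight:
  fixes p :: "'o::finite \<Rightarrow> real"
  shows "(\<Sum>xs\<in>{xs \<in> blocks (length ys). map f xs = ys}. iid_weight p xs) = iid_weight (marg p f) ys"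
proof (induction ys)
  case Nil
  have "{xs \<in> blocks (length []). map f xs = []} = {[]}" by auto
  then show ?case by simp
next
  case (Cons y ys)
  have "(\<Sum>xs\<in>{xs \<in> blocks (length (y # ys)). map f xs = y # ys}. iid_weight p xs)
      = (\<Sum>xs\<in>blocks (Suc (length ys)). if map f xs = y # ys then iid_weight p xs else 0)"
    by (subst sum.inter_filter[symmetric]) simp_all
  also have "\<dots> = (\<Sum>x\<in>UNIV. if f x = y then p x * (\<Sum>xs\<in>blocks (length ys). if map f xs = ys then iid_weight p xs else 0) else 0)"
    unfolding sum_blocks_Suc by (intro sum.cong refl) (simp add: sum_distrib_left if_distrib cong: if_cong)
  also have "\<dots> = (\<Sum>x\<in>{x\<in>UNIV. f x = y}. p x * iid_weight (marg p f) ys)"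
    unfolding Cons.IH[symmetric] by (subst (1 2) sum.inter_filter) simp_all
  also have "\<dots> = iid_weight (marg p f) (y # ys)"
    by (simp add: marg_def sum_distrib_right)
  finally show ?case .
qed

lemma expectation_marg:
  fixes p :: "'o::finite \<Rightarrow> real" and f :: "'o \<Rightarrow> 'a::finite" and g :: "'a \<Rightarrow> real"
  shows "(\<Sum>\<omega>\<in>UNIV. p \<omega> * g (f \<omega>)) = (\<Sum>a\<in>UNIV. marg p f a * g a)"
proof -
  have "(\<Sum>a\<in>UNIV. marg p f a * g a) = (\<Sum>a\<in>UNIV. \<Sum>\<omega>\<in>{\<omega>\<in>UNIV. f \<omega> = a}. p \<omega> * g (f \<omega>))"
    unfolding marg_def by (intro sum.cong refl) (simp add: sum_distrib_right)
  also have "\<dots> = (\<Sum>\<omega>\<in>UNIV. p \<omega> * g (f \<omega>))"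
    by (rule sum.group) auto
  finally show ?thesis by simp
qed

lemma sum_marg: "(\<Sum>a\<in>UNIV. marg p f a) = (\<Sum>\<omega>\<in>UNIV. p \<omega>)"
  for p :: "'o::finite \<Rightarrow> real" and f :: "'o \<Rightarrow> 'a::finite"
  using expectation_marg[of p "\<lambda>_. 1" f] by simp

lemma marg_nonneg: "(\<And>\<omega>. 0 \<le> p \<omega>) \<Longrightarrow> 0 \<le> marg p f a"
  by (simp add: marg_def sum_nonneg)

lemma marg_pos: "(\<And>\<omega>. 0 \<le> p \<omega>) \<Longrightarrow> 0 < p \<omega> \<Longrightarrow> 0 < marg p f (f \<omega>)"
  unfolding marg_def by (rule sum_pos2[where i = \<omega>]) auto

lemma marg_Pair_sum:
  fixes p :: "'o::finite \<Rightarrow> real" and f :: "'o \<Rightarrow> 'a::finite"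
  shows "(\<Sum>a\<in>UNIV. marg p (\<lambda>\<omega>. (f \<omega>, h \<omega>)) (a, s)) = marg p h s"
proof -
  have "(\<Sum>a\<in>UNIV. marg p (\<lambda>\<omega>. (f \<omega>, h \<omega>)) (a, s)) = (\<Sum>a\<in>UNIV. \<Sum>\<omega>\<in>{\<omega>\<in>{\<omega>. h \<omega> = s}. f \<omega> = a}. p \<omega>)"
    unfolding marg_def by (intro sum.cong) auto
  also have "\<dots> = marg p h s"
    unfolding marg_def by (rule sum.group) auto
  finally show ?thesis .
qed

lemma marg_Pair_le:
  assumes "\<And>\<omega>. 0 \<le> p \<omega>"
  shows "marg p (\<lambda>\<omega>. (f \<omega>, h \<omega>)) (a, s) \<le> marg p h s"
  unfolding marg_def using assms by (intro sum_mono2) auto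

section \<open>Entropies as expectations, and their nonnegativity\<close>

text \<open>Regrouping by outcomes turns entropies of variables with different ranges into sums over
  the same sample space, where they can be combined term by term.\<close>

lemma ent_eq_expectation:
  "ent p f = - (\<Sum>\<omega>\<in>UNIV. p \<omega> * log 2 (marg p f (f \<omega>)))"
proof -
  have "(\<Sum>z\<in>f ` UNIV. marg p f z * log 2 (marg p f z))
      = (\<Sum>z\<in>f ` UNIV. \<Sum>\<omega>\<in>{\<omega>\<in>UNIV. f \<omega> = z}. p \<omega> * log 2 (marg p f (f \<omega>)))"
    by (intro sum.cong refl) (simp add: marg_def sum_distrib_right)
  also have "\<dots> = (\<Sum>\<omega>\<in>UNIV. p \<omega> * log 2 (marg p f (f \<omega>)))"
    by (rule sum.group) auto
  finally show ?thesis by (simp add: ent_def marg_def)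
qed

lemma cent_eq_expectation:
  "cent p f g = (\<Sum>\<omega>\<in>UNIV. p \<omega> * (log 2 (marg p g (g \<omega>)) - log 2 (marg p (\<lambda>\<omega>. (f \<omega>, g \<omega>)) (f \<omega>, g \<omega>))))"
  by (simp add: cent_def ent_eq_expectation sum_subtractf algebra_simps)

lemma cent_nonneg:
  assumes p: "\<And>\<omega>. 0 \<le> p \<omega>"
  shows "0 \<le> cent p f g"
  unfolding cent_eq_expectation
proof (rule sum_nonneg)
  fix \<omega>
  show "0 \<le> p \<omega> * (log 2 (marg p g (g \<omega>)) - log 2 (marg p (\<lambda>\<omega>. (f \<omega>, g \<omega>)) (f \<omega>, g \<omega>)))"
  proof (cases "p \<omega> = 0")
    case False
    then have "0 < p \<omega>" using p[of \<omega>] by simp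
    then have "0 < marg p (\<lambda>\<omega>. (f \<omega>, g \<omega>)) (f \<omega>, g \<omega>)" "0 < marg p g (g \<omega>)"
      using marg_pos[of p \<omega> "\<lambda>\<omega>. (f \<omega>, g \<omega>)"] marg_pos[of p \<omega> g] p by auto
    then show ?thesis using p marg_Pair_le[of p f g, OF p] by simp
  qed simp
qed

text \<open>Gibbs' inequality: \<open>ln r \<le> r - 1\<close> applied to the ratio of the law under
  conditional independence to the true law, whose expectation is at most 1. It serves to show that
  the rate \<open>R0\<close> is nonnegative, without which no nonempty message set could meet the
  rate bound.\<close>

lemma cmi_nonneg:
  fixes p :: "'o::finite \<Rightarrow> real" and f :: "'o \<Rightarrow> 'a::finite" and g :: "'o \<Rightarrow> 'b::finite" and h :: "'o \<Rightarrow> 'c::finite"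
  assumes p: "\<And>\<omega>. 0 \<le> p \<omega>" and p1: "(\<Sum>\<omega>\<in>UNIV. p \<omega>) = 1"
  shows "0 \<le> cmi p f g h"
proof -
  define mh where "mh = marg p h"
  define mf where "mf = marg p (\<lambda>\<omega>. (f \<omega>, h \<omega>))"
  define mg where "mg = marg p (\<lambda>\<omega>. (g \<omega>, h \<omega>))"
  define mfg where "mfg = marg p (\<lambda>\<omega>. (f \<omega>, g \<omega>, h \<omega>))"
  have nn: "0 \<le> mh s" "0 \<le> mf as" "0 \<le> mg bs" "0 \<le> mfg abs" for s as bs abs
    by (simp_all add: mh_def mf_def mg_def mfg_def marg_nonneg p)
  define rat where "rat = (\<lambda>(a, b, s). mf (a, s) * mg (b, s) / (mh s * mfg (a, b, s)))"
  have "(\<Sum>\<omega>\<in>UNIV. p \<omega> * rat (f \<omega>, g \<omega>, h \<omega>)) = (\<Sum>abs\<in>UNIV. mfg abs * rat abs)"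
    unfolding mfg_def using expectation_marg[of p rat "\<lambda>\<omega>. (f \<omega>, g \<omega>, h \<omega>)"] by simp
  \<comment> \<open>Only an inequality: where \<open>mfg\<close> vanishes, the left term is 0 while
    the right one may be positive. Summing over a next turns \<open>mf\<close> into
    \<open>mh\<close>.\<close>
  also have "\<dots> \<le> (\<Sum>abs\<in>UNIV. case abs of (a, b, s) \<Rightarrow> mf (a, s) * mg (b, s) / mh s)"
    by (intro sum_mono) (auto simp: rat_def nn)
  also have "\<dots> = (\<Sum>a\<in>UNIV. \<Sum>(b, s)\<in>UNIV. mf (a, s) * mg (b, s) / mh s)"
    unfolding UNIV_Times_UNIV[symmetric] by (simp add: sum.cartesian_product case_prod_unfold del: UNIV_Times_UNIV)
  also have "\<dots> = (\<Sum>(b, s)\<in>UNIV. \<Sum>a\<in>UNIV. mf (a, s) * mg (b, s) / mh s)"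
    by (subst sum.swap) (simp add: case_prod_unfold)
  also have "\<dots> = (\<Sum>(b, s)\<in>UNIV. mh s * mg (b, s) / mh s)"
    by (simp add: sum_divide_distrib[symmetric] sum_distrib_right[symmetric] mf_def mh_def marg_Pair_sum)
  also have "\<dots> \<le> (\<Sum>bs\<in>UNIV. mg bs)"
    by (intro sum_mono) (auto simp: nn)
  also have "\<dots> = 1" using p1 by (simp add: mg_def sum_marg)
  finally have le1: "(\<Sum>\<omega>\<in>UNIV. p \<omega> * rat (f \<omega>, g \<omega>, h \<omega>)) \<le> 1" .
  have "0 \<le> (\<Sum>\<omega>\<in>UNIV. p \<omega> * (1 - rat (f \<omega>, g \<omega>, h \<omega>))) / ln 2"
    using le1 p1 by (simp add: algebra_simps sum_subtractf)
  also have "\<dots> = (\<Sum>\<omega>\<in>UNIV. p \<omega> * (1 - rat (f \<omega>, g \<omega>, h \<omega>)) / ln 2)"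
    by (rule sum_divide_distrib)
  also have "\<dots> \<le> (\<Sum>\<omega>\<in>UNIV. p \<omega> * (log 2 (mh (h \<omega>)) - log 2 (mf (f \<omega>, h \<omega>))
      - (log 2 (mg (g \<omega>, h \<omega>)) - log 2 (mfg (f \<omega>, g \<omega>, h \<omega>)))))"
  proof (rule sum_mono)
    fix \<omega>
    show "p \<omega> * (1 - rat (f \<omega>, g \<omega>, h \<omega>)) / ln 2 \<le> p \<omega> * (log 2 (mh (h \<omega>)) - log 2 (mf (f \<omega>, h \<omega>))
      - (log 2 (mg (g \<omega>, h \<omega>)) - log 2 (mfg (f \<omega>, g \<omega>, h \<omega>))))"
    proof (cases "p \<omega> = 0")
      case False
      then have "0 < p \<omega>" using p[of \<omega>] by simp
      then have pos: "0 < mh (h \<omega>)" "0 < mf (f \<omega>, h \<omega>)" "0 < mg (g \<omega>, h \<omega>)" "0 < mfg (f \<omega>, g \<omega>, h \<omega>)"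
        using marg_pos[of p \<omega> h] marg_pos[of p \<omega> "\<lambda>\<omega>. (f \<omega>, h \<omega>)"] marg_pos[of p \<omega> "\<lambda>\<omega>. (g \<omega>, h \<omega>)"]
          marg_pos[of p \<omega> "\<lambda>\<omega>. (f \<omega>, g \<omega>, h \<omega>)"] p
        by (auto simp: mh_def mf_def mg_def mfg_def)
      then have r: "0 < rat (f \<omega>, g \<omega>, h \<omega>)" by (simp add: rat_def)
      have "ln (rat (f \<omega>, g \<omega>, h \<omega>)) \<le> rat (f \<omega>, g \<omega>, h \<omega>) - 1" by (rule ln_le_minus_one[OF r])
      moreover have "ln (rat (f \<omega>, g \<omega>, h \<omega>)) = ln (mf (f \<omega>, h \<omega>)) + ln (mg (g \<omega>, h \<omega>)) - ln (mh (h \<omega>)) - ln (mfg (f \<omega>, g \<omega>, h \<omega>))"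
        using pos by (simp add: rat_def ln_mult ln_div)
      ultimately have "(1 - rat (f \<omega>, g \<omega>, h \<omega>)) / ln 2
          \<le> (ln (mh (h \<omega>)) - ln (mf (f \<omega>, h \<omega>)) - (ln (mg (g \<omega>, h \<omega>)) - ln (mfg (f \<omega>, g \<omega>, h \<omega>)))) / ln 2"
        by (intro divide_right_mono) auto
      then have "p \<omega> * ((1 - rat (f \<omega>, g \<omega>, h \<omega>)) / ln 2) \<le> p \<omega> *
          ((ln (mh (h \<omega>)) - ln (mf (f \<omega>, h \<omega>)) - (ln (mg (g \<omega>, h \<omega>)) - ln (mfg (f \<omega>, g \<omega>, h \<omega>)))) / ln 2)"
        using p by (rule mult_left_mono)
      then show ?thesis
        unfolding log_def diff_divide_distrib[symmetric] by simp
    qed simp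
  qed
  also have "\<dots> = cmi p f g h"
    unfolding cmi_def cent_eq_expectation sum_subtractf[symmetric] mh_def mf_def mg_def mfg_def
    by (intro sum.cong refl) (simp add: algebra_simps)
  finally show ?thesis .
qed

section \<open>Weak law of large numbers and conditional typicality\<close>

text \<open>Splitting off the first letter, the cross term contains the mean of g, which is
  0.\<close>

lemma iid_second_moment:
  fixes p g :: "'o::finite \<Rightarrow> real"
  assumes p1: "(\<Sum>\<omega>\<in>UNIV. p \<omega>) = 1" and g: "(\<Sum>\<omega>\<in>UNIV. p \<omega> * g \<omega>) = 0"
  shows "(\<Sum>xs\<in>blocks n. iid_weight p xs * (\<Sum>x\<leftarrow>xs. g x)\<^sup>2) = real n * (\<Sum>\<omega>\<in>UNIV. p \<omega> * (g \<omega>)\<^sup>2)"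
proof (induction n)
  case (Suc n)
  let ?S = "\<lambda>xs. \<Sum>x\<leftarrow>xs. g x"
  have "(\<Sum>xs\<in>blocks (Suc n). iid_weight p xs * (?S xs)\<^sup>2)
      = (\<Sum>x\<in>UNIV. \<Sum>xs\<in>blocks n. p x * (g x)\<^sup>2 * iid_weight p xs
          + 2 * (p x * g x) * (iid_weight p xs * ?S xs) + p x * (iid_weight p xs * (?S xs)\<^sup>2))"
    unfolding sum_blocks_Suc by (intro sum.cong refl) (simp add: power2_sum algebra_simps)
  also have "\<dots> = (\<Sum>x\<in>UNIV. p x * (g x)\<^sup>2) * (\<Sum>xs\<in>blocks n. iid_weight p xs)
      + 2 * (\<Sum>x\<in>UNIV. p x * g x) * (\<Sum>xs\<in>blocks n. iid_weight p xs * ?S xs)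
      + (\<Sum>x\<in>UNIV. p x) * (\<Sum>xs\<in>blocks n. iid_weight p xs * (?S xs)\<^sup>2)"
    by (simp only: sum.distrib sum_distrib_left[symmetric] sum_distrib_right[symmetric])
  finally show ?case
    using p1 g Suc by (simp add: sum_iid_weight algebra_simps)
qed simp

text \<open>Chebyshev's inequality for g centred at its mean. The upper tail suffices, because
  typicality and heaviness are both conditions on one side.\<close>

lemma weak_law:
  fixes p g :: "'o::finite \<Rightarrow> real"
  assumes p: "\<And>\<omega>. 0 \<le> p \<omega>" and p1: "(\<Sum>\<omega>\<in>UNIV. p \<omega>) = 1"
    and \<alpha>: "(\<Sum>\<omega>\<in>UNIV. p \<omega> * g \<omega>) < \<alpha>"
  shows "(\<lambda>n. \<Sum>xs\<in>{xs \<in> blocks n. real n * \<alpha> < (\<Sum>x\<leftarrow>xs. g x)}. iid_weight p xs) \<longlonglongrightarrow> 0"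
proof -
  define \<mu> where "\<mu> = (\<Sum>\<omega>\<in>UNIV. p \<omega> * g \<omega>)"
  define V where "V = (\<Sum>\<omega>\<in>UNIV. p \<omega> * (g \<omega> - \<mu>)\<^sup>2)"
  let ?P = "\<lambda>n. \<Sum>xs\<in>{xs \<in> blocks n. real n * \<alpha> < (\<Sum>x\<leftarrow>xs. g x)}. iid_weight p xs"
  have d: "0 < \<alpha> - \<mu>" using \<alpha> by (simp add: \<mu>_def)
  have center: "(\<Sum>\<omega>\<in>UNIV. p \<omega> * (g \<omega> - \<mu>)) = 0"
    using p1 by (simp add: right_diff_distrib sum_subtractf sum_distrib_right[symmetric] \<mu>_def)
  have bound: "?P n \<le> V / (\<alpha> - \<mu>)\<^sup>2 / real n" if n: "0 < n" for n
  proof -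
    have S: "(\<Sum>x\<leftarrow>xs. g x - \<mu>) = (\<Sum>x\<leftarrow>xs. g x) - real (length xs) * \<mu>" for xs
      by (induction xs) (auto simp: algebra_simps)
    have "?P n * (real n * (\<alpha> - \<mu>))\<^sup>2 = (\<Sum>xs\<in>{xs \<in> blocks n. real n * \<alpha> < (\<Sum>x\<leftarrow>xs. g x)}. iid_weight p xs * (real n * (\<alpha> - \<mu>))\<^sup>2)"
      by (rule sum_distrib_right)
    also have "\<dots> \<le> (\<Sum>xs\<in>{xs \<in> blocks n. real n * \<alpha> < (\<Sum>x\<leftarrow>xs. g x)}. iid_weight p xs * (\<Sum>x\<leftarrow>xs. g x - \<mu>)\<^sup>2)"
    proof (intro sum_mono mult_left_mono power_mono)
      fix xs assume "xs \<in> {xs \<in> blocks n. real n * \<alpha> < (\<Sum>x\<leftarrow>xs. g x)}"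
      then show "real n * (\<alpha> - \<mu>) \<le> (\<Sum>x\<leftarrow>xs. g x - \<mu>)" unfolding S by (simp add: algebra_simps)
    qed (use d p in \<open>auto simp: iid_weight_nonneg\<close>)
    also have "\<dots> \<le> (\<Sum>xs\<in>blocks n. iid_weight p xs * (\<Sum>x\<leftarrow>xs. g x - \<mu>)\<^sup>2)"
      using p by (intro sum_mono2) (auto simp: iid_weight_nonneg)
    also have "\<dots> = real n * V"
      unfolding V_def by (rule iid_second_moment[OF p1 center])
    finally have "real n * (?P n * (real n * (\<alpha> - \<mu>)\<^sup>2)) \<le> real n * V"
      by (simp add: power_mult_distrib power2_eq_square mult_ac)
    then have "?P n * (real n * (\<alpha> - \<mu>)\<^sup>2) \<le> V" using n by simp
    then show ?thesis using n d by (simp add: pos_le_divide_eq mult_ac)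
  qed
  have lim: "(\<lambda>n. V / (\<alpha> - \<mu>)\<^sup>2 / real n) \<longlonglongrightarrow> 0"
    by (rule lim_const_over_n)
  show ?thesis
  proof (rule tendsto_sandwich[OF _ _ tendsto_const lim])
    show "\<forall>\<^sub>F n in sequentially. 0 \<le> ?P n"
      using p by (intro always_eventually allI sum_nonneg) (auto simp: iid_weight_nonneg)
    show "\<forall>\<^sub>F n in sequentially. ?P n \<le> V / (\<alpha> - \<mu>)\<^sup>2 / real n"
      by (rule eventually_mono[OF eventually_gt_at_top[of 0] bound])
  qed
qed

text \<open>The condition that the conditional probability of \<open>as\<close> given
  \<open>bs\<close> is at least \<open>2 powr (- n * \<alpha>)\<close>, multiplied out so that no
  quotient or logarithm of 0 occurs. Blocks \<open>bs\<close> of probability 0 satisfy it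
  trivially.\<close>

definition typical_set :: "('o::finite \<Rightarrow> real) \<Rightarrow> ('o \<Rightarrow> 'a) \<Rightarrow> ('o \<Rightarrow> 'b) \<Rightarrow> real \<Rightarrow> nat \<Rightarrow> ('a list \<times> 'b list) set" where
  "typical_set p f g \<alpha> n = {(as, bs).
     2 powr (- real n * \<alpha>) * iid_weight (marg p g) bs \<le> iid_weight (marg p (\<lambda>\<omega>. (f \<omega>, g \<omega>))) (zip as bs)}"

text \<open>On a block of positive weight all marginals are positive, and atypicality says that the
  sum of the conditional information densities d exceeds \<open>n * \<alpha>\<close>. The mean of d
  is the conditional entropy, so the weak law applies; blocks of weight 0 contribute
  nothing.\<close>

lemma atypical_tendsto_0:
  fixes p :: "'o::finite \<Rightarrow> real"
  assumes p: "\<And>\<omega>. 0 \<le> p \<omega>" and p1: "(\<Sum>\<omega>\<in>UNIV. p \<omega>) = 1" and \<alpha>: "cent p f g < \<alpha>"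
  shows "(\<lambda>n. \<Sum>js\<in>{js \<in> blocks n. (map f js, map g js) \<notin> typical_set p f g \<alpha> n}. iid_weight p js) \<longlonglongrightarrow> 0"
    (is "?P \<longlonglongrightarrow> 0")
proof -
  define d where "d \<omega> = log 2 (marg p g (g \<omega>)) - log 2 (marg p (\<lambda>\<omega>. (f \<omega>, g \<omega>)) (f \<omega>, g \<omega>))" for \<omega>
  let ?W = "\<lambda>n. \<Sum>xs\<in>{xs \<in> blocks n. real n * \<alpha> < (\<Sum>x\<leftarrow>xs. d x)}. iid_weight p xs"
  have W: "?W \<longlonglongrightarrow> 0"
    by (rule weak_law[OF p p1]) (use \<alpha> in \<open>simp add: cent_eq_expectation d_def\<close>)
  have atyp: "real n * \<alpha> < (\<Sum>x\<leftarrow>js. d x)"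
    if js: "length js = n" "(map f js, map g js) \<notin> typical_set p f g \<alpha> n" "iid_weight p js \<noteq> 0" for js n
  proof -
    let ?fg = "\<lambda>\<omega>. (f \<omega>, g \<omega>)"
    have pos: "0 < p j" if "j \<in> set js" for j
      using js(3) that p[of j] by (auto simp: iid_weight_eq_0_iff less_le)
    have mg: "0 < marg p g (g j)" and mfg: "0 < marg p ?fg (f j, g j)" if "j \<in> set js" for j
      using marg_pos[of p j g] marg_pos[of p j ?fg] p pos[OF that] by auto
    let ?B = "iid_weight (marg p g) (map g js)" and ?AB = "iid_weight (marg p ?fg) (zip (map f js) (map g js))"
    have z: "zip (map f js) (map g js) = map ?fg js" by (induction js) auto
    have posB: "0 < ?B" and posAB: "0 < ?AB"
      unfolding z iid_weight_map using mg mfg by (auto intro!: iid_weight_pos)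
    have lB: "log 2 ?B = (\<Sum>j\<leftarrow>js. log 2 (marg p g (g j)))"
      unfolding iid_weight_map using mg by (rule log_iid_weight)
    have lAB: "log 2 ?AB = (\<Sum>j\<leftarrow>js. log 2 (marg p ?fg (f j, g j)))"
      unfolding z iid_weight_map using mfg by (rule log_iid_weight)
    have "?AB < 2 powr (- real n * \<alpha>) * ?B"
      using js(2) by (simp add: typical_set_def)
    then have "log 2 ?AB < log 2 (2 powr (- real n * \<alpha>) * ?B)"
      using posAB posB by simp
    also have "\<dots> = - real n * \<alpha> + log 2 ?B"
      using posB by (simp add: log_mult)
    finally show ?thesis
      unfolding lB lAB d_def by (simp add: sum_list_subtractf)
  qed
  have "?P n \<le> ?W n" for n
    unfolding sum.inter_filter[OF finite_blocks]
  proof (rule sum_mono)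
    fix js :: "'o list" assume "js \<in> blocks n"
    then show "(if (map f js, map g js) \<notin> typical_set p f g \<alpha> n then iid_weight p js else 0)
        \<le> (if real n * \<alpha> < (\<Sum>x\<leftarrow>js. d x) then iid_weight p js else 0)"
      using atyp[of js n] iid_weight_nonneg[of p js] p by auto
  qed
  moreover have "0 \<le> ?P n" for n
    using p by (intro sum_nonneg) (auto simp: iid_weight_nonneg)
  ultimately show ?thesis
    by (intro tendsto_sandwich[OF _ _ tendsto_const W] always_eventually) auto
qed

text \<open>Typicality gives \<open>P(bs) \<le> 2 powr (n * \<alpha>) * P(as, bs)\<close>, and the
  joint probabilities sum to 1. Weighting by the law of the side information makes blocks
  \<open>bs\<close> of probability 0 harmless.\<close>

lemma typical_set_card_expectation:
  fixes p :: "'o::finite \<Rightarrow> real" and f :: "'o \<Rightarrow> 'a::finite" and g :: "'o \<Rightarrow> 'b::finite"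
  assumes p: "\<And>\<omega>. 0 \<le> p \<omega>" and p1: "(\<Sum>\<omega>\<in>UNIV. p \<omega>) = 1"
  shows "(\<Sum>js\<in>blocks n. iid_weight p js * real (card {as \<in> blocks n. (as, map g js) \<in> typical_set p f g \<alpha> n}))
    \<le> 2 powr (real n * \<alpha>)"
proof -
  let ?T = "typical_set p f g \<alpha> n" and ?fg = "\<lambda>\<omega>. (f \<omega>, g \<omega>)"
  let ?N = "\<lambda>bs. real (card {as \<in> blocks n. (as, bs) \<in> ?T})"
  have "(\<Sum>js\<in>blocks n. iid_weight p js * ?N (map g js))
      = (\<Sum>bs\<in>blocks n. \<Sum>js\<in>{js\<in>blocks n. map g js = bs}. iid_weight p js * ?N (map g js))"
    by (rule sum.group[symmetric]) auto
  also have "\<dots> = (\<Sum>bs\<in>blocks n. iid_weight (marg p g) bs * ?N bs)"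
    by (intro sum.cong refl) (auto simp: marg_iid_weight[symmetric] sum_distrib_right)
  also have "\<dots> = (\<Sum>bs\<in>blocks n. \<Sum>as\<in>{as \<in> blocks n. (as, bs) \<in> ?T}. iid_weight (marg p g) bs)"
    by (simp add: mult.commute)
  also have "\<dots> \<le> (\<Sum>bs\<in>blocks n. \<Sum>as\<in>{as \<in> blocks n. (as, bs) \<in> ?T}. 2 powr (real n * \<alpha>) * iid_weight (marg p ?fg) (zip as bs))"
  proof (intro sum_mono)
    fix as bs assume "as \<in> {as \<in> blocks n. (as, bs) \<in> ?T}"
    then have "2 powr (real n * \<alpha>) * (2 powr (- real n * \<alpha>) * iid_weight (marg p g) bs)
        \<le> 2 powr (real n * \<alpha>) * iid_weight (marg p ?fg) (zip as bs)"
      by (intro mult_left_mono) (auto simp: typical_set_def)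
    then show "iid_weight (marg p g) bs \<le> 2 powr (real n * \<alpha>) * iid_weight (marg p ?fg) (zip as bs)"
      by (simp add: mult.assoc[symmetric] powr_add[symmetric])
  qed
  also have "\<dots> \<le> (\<Sum>bs\<in>blocks n. \<Sum>as\<in>blocks n. 2 powr (real n * \<alpha>) * iid_weight (marg p ?fg) (zip as bs))"
    using p by (intro sum_mono sum_mono2) (auto intro!: mult_nonneg_nonneg iid_weight_nonneg marg_nonneg)
  also have "\<dots> = 2 powr (real n * \<alpha>) * (\<Sum>js\<in>blocks n. iid_weight (marg p ?fg) js)"
    by (simp add: sum_blocks_zip sum_distrib_left)
  also have "\<dots> = 2 powr (real n * \<alpha>)"
    using p1 by (simp add: sum_iid_weight sum_marg)
  finally show ?thesis .
qed

section \<open>Block codes from double binning\<close>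

abbreviation prj_w :: "'w \<times> 'x \<times> 'y \<times> 'u \<times> 'v \<Rightarrow> 'w" where "prj_w \<equiv> \<lambda>(w, x, y, u, v). w"
abbreviation prj_x :: "'w \<times> 'x \<times> 'y \<times> 'u \<times> 'v \<Rightarrow> 'x" where "prj_x \<equiv> \<lambda>(w, x, y, u, v). x"
abbreviation prj_y :: "'w \<times> 'x \<times> 'y \<times> 'u \<times> 'v \<Rightarrow> 'y" where "prj_y \<equiv> \<lambda>(w, x, y, u, v). y"
abbreviation prj_u :: "'w \<times> 'x \<times> 'y \<times> 'u \<times> 'v \<Rightarrow> 'u" where "prj_u \<equiv> \<lambda>(w, x, y, u, v). u"
abbreviation prj_v :: "'w \<times> 'x \<times> 'y \<times> 'u \<times> 'v \<Rightarrow> 'v" where "prj_v \<equiv> \<lambda>(w, x, y, u, v). v"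
abbreviation prj_wu :: "'w \<times> 'x \<times> 'y \<times> 'u \<times> 'v \<Rightarrow> 'w \<times> 'u" where "prj_wu \<equiv> \<lambda>(w, x, y, u, v). (w, u)"
abbreviation prj_wv :: "'w \<times> 'x \<times> 'y \<times> 'u \<times> 'v \<Rightarrow> 'w \<times> 'v" where "prj_wv \<equiv> \<lambda>(w, x, y, u, v). (w, v)"

abbreviation seq_x :: "('x \<times> 'y \<times> 'u \<times> 'v) list \<Rightarrow> 'x list" where "seq_x \<equiv> map fst"
abbreviation seq_y :: "('x \<times> 'y \<times> 'u \<times> 'v) list \<Rightarrow> 'y list" where "seq_y \<equiv> map (fst \<circ> snd)"
abbreviation seq_u :: "('x \<times> 'y \<times> 'u \<times> 'v) list \<Rightarrow> 'u list" where "seq_u \<equiv> map (fst \<circ> snd \<circ> snd)"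
abbreviation seq_v :: "('x \<times> 'y \<times> 'u \<times> 'v) list \<Rightarrow> 'v list" where "seq_v \<equiv> map (snd \<circ> snd \<circ> snd)"

lemma map_prj_zip:
  assumes "length ws = length zs"
  shows "map prj_w (zip ws zs) = ws" "map prj_x (zip ws zs) = seq_x zs" "map prj_y (zip ws zs) = seq_y zs"
    "map prj_u (zip ws zs) = seq_u zs" "map prj_v (zip ws zs) = seq_v zs"
    "map prj_wu (zip ws zs) = zip ws (seq_u zs)" "map prj_wv (zip ws zs) = zip ws (seq_v zs)"
  using assms by (induction ws zs rule: list_induct2) auto

definition block_kernel :: "('x \<Rightarrow> 'y \<Rightarrow> 'w \<Rightarrow> real) \<Rightarrow> 'x list \<times> 'y list \<Rightarrow> 'w list \<Rightarrow> real" where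
  "block_kernel c z ws = iid_weight (\<lambda>(w, x, y). c x y w) (zip ws (zip (fst z) (snd z)))"

text \<open>Identifies the ideal law of \<open>fix_shared_randomness\<close>, source times kernel,
  with the i.i.d. law of the joint letters.\<close>

lemma iid_weight_joint_p:
  assumes "length ws = length zs"
  shows "iid_weight (joint_p c Q) (zip ws zs) = iid_prob Q zs * block_kernel c (seq_x zs, seq_y zs) ws"
  using assms
  by (induction ws zs rule: list_induct2) (auto simp: joint_p_def iid_prob_def block_kernel_def)

text \<open>Makes heaviness of a block of W given the source an event of the joint i.i.d. block, to
  which the weak law applies.\<close>

lemma block_kernel_zip:
  assumes "length ws = length zs"
  shows "block_kernel c (seq_x zs, seq_y zs) ws = iid_weight (\<lambda>(w, x, y, uv). c x y w) (zip ws zs)"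
  using assms
  by (induction ws zs rule: list_induct2) (auto simp: block_kernel_def)

lemma iid_prob_nonneg: "0 \<le> iid_prob Q zs"
  by (induction zs) (auto simp: iid_prob_def)

lemma sum_iid_prob: "(\<Sum>zs\<in>blocks n. iid_prob Q zs) = 1" for Q :: "'a::finite pmf"
  using sum_iid_weight[where p = "pmf Q" and n = n] sum_pmf_eq_1[of UNIV Q]
  by (simp add: iid_prob_def iid_weight_def)

lemma cond_kernels_nonneg: "c \<in> cond_kernels \<Longrightarrow> 0 \<le> c x y w"
  and cond_kernels_sum: "c \<in> cond_kernels \<Longrightarrow> (\<Sum>w\<in>UNIV. c x y w) = 1"
  by (auto simp: cond_kernels_def)

lemma block_kernel_nonneg: "c \<in> cond_kernels \<Longrightarrow> 0 \<le> block_kernel c z ws"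
  unfolding block_kernel_def by (intro iid_weight_nonneg) (auto simp: cond_kernels_nonneg)

lemma sum_block_kernel:
  assumes c: "c \<in> cond_kernels"
  shows "(\<Sum>ws\<in>blocks (length zs). block_kernel c (seq_x zs, seq_y zs) ws) = 1"
proof (induction zs)
  case Nil
  have "(blocks (length []) :: 'a list set) = {[]}" by auto
  then show ?case by (simp add: block_kernel_def)
next
  case (Cons z zs)
  then show ?case
    using c by (simp add: sum_blocks_Suc block_kernel_def sum_distrib_left[symmetric] cond_kernels_sum)
qed

lemma joint_p_nonneg: "c \<in> cond_kernels \<Longrightarrow> 0 \<le> joint_p c Q j"
  by (auto simp: joint_p_def cond_kernels_nonneg split: prod.split)

lemma sum_joint_p:
  fixes Q :: "('x::finite \<times> 'y::finite \<times> 'u::finite \<times> 'v::finite) pmf" and c :: "'x \<Rightarrow> 'y \<Rightarrow> 'w::finite \<Rightarrow> real"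
  assumes c: "c \<in> cond_kernels"
  shows "(\<Sum>j\<in>UNIV. joint_p c Q j) = 1"
proof -
  have "(\<Sum>j\<in>UNIV. joint_p c Q j) = (\<Sum>w\<in>UNIV. \<Sum>z\<in>UNIV. joint_p c Q (w, z))"
    unfolding UNIV_Times_UNIV[symmetric] by (simp add: sum.cartesian_product del: UNIV_Times_UNIV)
  also have "\<dots> = (\<Sum>z\<in>UNIV. \<Sum>w\<in>UNIV. joint_p c Q (w, z))"
    by (rule sum.swap)
  also have "\<dots> = (\<Sum>z\<in>UNIV. pmf Q z)"
    by (intro sum.cong refl)
      (auto simp: joint_p_def sum_distrib_right[symmetric] cond_kernels_sum[OF c] split: prod.split)
  also have "\<dots> = 1" by (rule sum_pmf_eq_1) auto
  finally show ?thesis .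
qed

section \<open>Random binning under the ideal law\<close>

definition collision_prob :: "('o::finite \<Rightarrow> real) \<Rightarrow> ('o \<Rightarrow> 'a) \<Rightarrow> ('o \<Rightarrow> 'b) \<Rightarrow> real \<Rightarrow> nat \<Rightarrow> ('a list \<Rightarrow> 'h) \<Rightarrow> real" where
  "collision_prob p f g \<alpha> n h = (\<Sum>js\<in>{js \<in> blocks n.
     collides h (typical_set p f g \<alpha> n) (blocks n) (map f js) (map g js)}. iid_weight p js)"

definition atypical_prob :: "('o::finite \<Rightarrow> real) \<Rightarrow> ('o \<Rightarrow> 'a) \<Rightarrow> ('o \<Rightarrow> 'b) \<Rightarrow> real \<Rightarrow> nat \<Rightarrow> real" where
  "atypical_prob p f g \<alpha> n = (\<Sum>js\<in>{js \<in> blocks n. (map f js, map g js) \<notin> typical_set p f g \<alpha> n}. iid_weight p js)"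

lemma average_collision_prob:
  fixes p :: "'o::finite \<Rightarrow> real" and f :: "'o \<Rightarrow> 'a::finite" and g :: "'o \<Rightarrow> 'b::finite"
  assumes p: "\<And>\<omega>. 0 \<le> p \<omega>" and p1: "(\<Sum>\<omega>\<in>UNIV. p \<omega>) = 1"
    and uni: "universal_hash H hf (blocks n) \<kappa>" and \<kappa>: "0 \<le> \<kappa>"
  shows "(\<Sum>h\<in>H. collision_prob p f g \<alpha> n (hf h))
    \<le> real (card H) * (atypical_prob p f g \<alpha> n + \<kappa> * 2 powr (real n * \<alpha>))"
proof -
  have "(\<Sum>h\<in>H. collision_prob p f g \<alpha> n (hf h)) \<le> real (card H) * (atypical_prob p f g \<alpha> n
      + \<kappa> * (\<Sum>js\<in>blocks n. iid_weight p js * real (card {as \<in> blocks n. (as, map g js) \<in> typical_set p f g \<alpha> n})))"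
    unfolding collision_prob_def atypical_prob_def
    by (rule average_collision[OF uni]) (use p \<kappa> in \<open>auto intro: iid_weight_nonneg\<close>)
  also have "\<dots> \<le> real (card H) * (atypical_prob p f g \<alpha> n + \<kappa> * 2 powr (real n * \<alpha>))"
    using typical_set_card_expectation[OF p p1, where n = n and \<alpha> = \<alpha> and f = f and g = g] \<kappa>
    by (intro mult_left_mono add_left_mono) auto
  finally show ?thesis .
qed

lemma exists_binning:
  fixes p :: "'o::finite \<Rightarrow> real" and f :: "'o \<Rightarrow> 'a::finite" and g :: "'o \<Rightarrow> 'b::finite"
  assumes p: "\<And>\<omega>. 0 \<le> p \<omega>" and p1: "(\<Sum>\<omega>\<in>UNIV. p \<omega>) = 1" and m: "1 \<le> m"
  shows "\<exists>h \<in> blocks n \<rightarrow>\<^sub>E {1..m}.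
    collision_prob p f g \<alpha> n h \<le> atypical_prob p f g \<alpha> n + 2 powr (real n * \<alpha>) / real m"
proof -
  have uni: "universal_hash (blocks n \<rightarrow>\<^sub>E {1..m}) (\<lambda>h. h) (blocks n :: 'a list set) (1 / real m)"
    using m by (intro universal_hash_PiE) auto
  then show ?thesis
    using average_collision_prob[OF p p1 uni, of f g \<alpha>]
    by (intro exists_le_average) (auto simp: universal_hash_def)
qed

text \<open>The expected L1 distance, over the source, between the conditional law of
  \<open>F\<close> of the block of W and the uniform law on the m bins.\<close>

definition bin_deviation :: "('x \<Rightarrow> 'y \<Rightarrow> 'w::finite \<Rightarrow> real) \<Rightarrow> ('x::finite \<times> 'y::finite \<times> 'u::finite \<times> 'v::finite) pmf
    \<Rightarrow> nat \<Rightarrow> nat \<Rightarrow> ('w list \<Rightarrow> nat) \<Rightarrow> real" where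
  "bin_deviation c Q n m F = (\<Sum>zs\<in>blocks n. iid_prob Q zs * (\<Sum>f\<in>{1..m}.
     \<bar>(\<Sum>ws\<in>{ws\<in>blocks n. F ws = f}. block_kernel c (seq_x zs, seq_y zs) ws) - 1 / real m\<bar>))"

definition heavy_prob :: "('x \<Rightarrow> 'y \<Rightarrow> 'w::finite \<Rightarrow> real) \<Rightarrow> ('x::finite \<times> 'y::finite \<times> 'u::finite \<times> 'v::finite) pmf
    \<Rightarrow> real \<Rightarrow> nat \<Rightarrow> real" where
  "heavy_prob c Q \<tau> n = (\<Sum>js\<in>{js\<in>blocks n. \<tau> < iid_weight (\<lambda>(w, x, y, uv). c x y w) js}. iid_weight (joint_p c Q) js)"

text \<open>The leftover hash lemma is applied to the kernel for each source block separately. Its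
  square-root term does not depend on the block, and the conditional heavy masses average to
  \<open>heavy_prob\<close>.\<close>

lemma average_bin_deviation:
  fixes Q :: "('x::finite \<times> 'y::finite \<times> 'u::finite \<times> 'v::finite) pmf" and c :: "'x \<Rightarrow> 'y \<Rightarrow> 'w::finite \<Rightarrow> real"
    and n m :: nat
  assumes c: "c \<in> cond_kernels" and m: "1 \<le> m" and \<tau>: "0 \<le> \<tau>"
  defines "H \<equiv> (blocks n :: 'w list set) \<rightarrow>\<^sub>E {1..m}"
  shows "(\<Sum>F\<in>H. bin_deviation c Q n m F)
    \<le> real (card H) * (2 * heavy_prob c Q \<tau> n + sqrt ((real m - 1) * \<tau>))"
proof -
  let ?k = "\<lambda>zs. block_kernel c (seq_x zs, seq_y zs)"
  let ?b = "sqrt ((real m - 1) * \<tau>)"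
  have uni: "universal_hash H (\<lambda>h. h) (blocks n) (1 / real m)"
    unfolding H_def using m by (intro universal_hash_PiE) auto
  have "(\<Sum>F\<in>H. bin_deviation c Q n m F) = (\<Sum>zs\<in>blocks n. iid_prob Q zs *
      (\<Sum>F\<in>H. \<Sum>f\<in>{1..m}. \<bar>(\<Sum>ws\<in>{ws\<in>blocks n. F ws = f}. ?k zs ws) - 1 / real m\<bar>))"
    unfolding bin_deviation_def by (subst sum.swap) (simp add: sum_distrib_left)
  also have "\<dots> \<le> (\<Sum>zs\<in>blocks n. iid_prob Q zs *
      (real (card H) * (2 * (\<Sum>ws\<in>{ws\<in>blocks n. \<tau> < ?k zs ws}. ?k zs ws) + ?b)))"
  proof (intro sum_mono mult_left_mono iid_prob_nonneg)
    fix zs :: "('x \<times> 'y \<times> 'u \<times> 'v) list" assume "zs \<in> blocks n"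
    then show "(\<Sum>F\<in>H. \<Sum>f\<in>{1..m}. \<bar>(\<Sum>ws\<in>{ws\<in>blocks n. F ws = f}. ?k zs ws) - 1 / real m\<bar>)
        \<le> real (card H) * (2 * (\<Sum>ws\<in>{ws\<in>blocks n. \<tau> < ?k zs ws}. ?k zs ws) + ?b)"
      using sum_block_kernel[OF c, of zs] block_kernel_nonneg[OF c]
      by (intro leftover_hash[OF uni _ m _ _ _ \<tau>]) (auto simp: H_def PiE_iff)
  qed
  also have "\<dots> = real (card H) * (2 * (\<Sum>zs\<in>blocks n. iid_prob Q zs * (\<Sum>ws\<in>{ws\<in>blocks n. \<tau> < ?k zs ws}. ?k zs ws))
      + (\<Sum>zs\<in>blocks n. iid_prob Q zs) * ?b)"
    by (simp add: sum.distrib sum_distrib_left sum_distrib_right algebra_simps)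
  also have "(\<Sum>zs\<in>blocks n. iid_prob Q zs * (\<Sum>ws\<in>{ws\<in>blocks n. \<tau> < ?k zs ws}. ?k zs ws))
      = (\<Sum>zs\<in>blocks n. \<Sum>ws\<in>blocks n. if \<tau> < iid_weight (\<lambda>(w, x, y, uv). c x y w) (zip ws zs)
          then iid_weight (joint_p c Q) (zip ws zs) else 0)"
    unfolding sum.inter_filter[OF finite_blocks] sum_distrib_left
    by (intro sum.cong refl) (simp add: iid_weight_joint_p block_kernel_zip)
  also have "\<dots> = heavy_prob c Q \<tau> n"
    unfolding heavy_prob_def sum.inter_filter[OF finite_blocks] by (rule sum_blocks_zip[symmetric])
  finally show ?thesis by (simp add: sum_iid_prob)
qed

text \<open>The three averages over pairs (F, G) are added before choosing, since the same pair must
  be good for both decoders and for uniformity.\<close>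

lemma exists_double_binning:
  fixes Q :: "('x::finite \<times> 'y::finite \<times> 'u::finite \<times> 'v::finite) pmf" and c :: "'x \<Rightarrow> 'y \<Rightarrow> 'w::finite \<Rightarrow> real"
  assumes c: "c \<in> cond_kernels" and m: "1 \<le> m" "1 \<le> m0" and \<tau>: "0 \<le> \<tau>"
  defines "p \<equiv> joint_p c Q"
  shows "\<exists>F \<in> blocks n \<rightarrow>\<^sub>E {1..m}. \<exists>G \<in> blocks n \<rightarrow>\<^sub>E {1..m0}.
    collision_prob p prj_w prj_u \<alpha> n (\<lambda>w. (F w, G w)) + collision_prob p prj_w prj_v \<beta> n (\<lambda>w. (F w, G w))
      + 2 * bin_deviation c Q n m F
    \<le> (atypical_prob p prj_w prj_u \<alpha> n + 2 powr (real n * \<alpha>) / (real m * real m0))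
      + (atypical_prob p prj_w prj_v \<beta> n + 2 powr (real n * \<beta>) / (real m * real m0))
      + 2 * (2 * heavy_prob c Q \<tau> n + sqrt ((real m - 1) * \<tau>))"
    (is "\<exists>F\<in>_. \<exists>G\<in>_. _ \<le> ?bu + ?bv + 2 * ?bd")
proof -
  let ?H = "(blocks n :: 'w list set) \<rightarrow>\<^sub>E {1..m}" and ?K = "(blocks n :: 'w list set) \<rightarrow>\<^sub>E {1..m0}"
  let ?hf = "\<lambda>(F, G) w. (F w, G w)"
  have uH: "universal_hash ?H (\<lambda>h. h) (blocks n) (1 / real m)"
    and uK: "universal_hash ?K (\<lambda>h. h) (blocks n) (1 / real m0)"
    by (rule universal_hash_PiE[OF finite_blocks m(1)], rule universal_hash_PiE[OF finite_blocks m(2)])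
  have uni: "universal_hash (?H \<times> ?K) ?hf (blocks n) (1 / real m * (1 / real m0))"
    using universal_hash_Times[OF uH uK] by simp
  have p: "0 \<le> p j" "(\<Sum>j\<in>UNIV. p j) = 1" for j
    using c by (auto simp: p_def joint_p_nonneg sum_joint_p)
  have u: "(\<Sum>h\<in>?H \<times> ?K. collision_prob p prj_w prj_u \<alpha> n (?hf h)) \<le> real (card (?H \<times> ?K)) * ?bu"
    using average_collision_prob[OF p uni, of prj_w prj_u \<alpha>] by simp
  have v: "(\<Sum>h\<in>?H \<times> ?K. collision_prob p prj_w prj_v \<beta> n (?hf h)) \<le> real (card (?H \<times> ?K)) * ?bv"
    using average_collision_prob[OF p uni, of prj_w prj_v \<beta>] by simp
  have "(\<Sum>h\<in>?H \<times> ?K. bin_deviation c Q n m (fst h)) = (\<Sum>F\<in>?H. \<Sum>G\<in>?K. bin_deviation c Q n m F)"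
    by (simp only: sum.cartesian_product case_prod_unfold)
  also have "\<dots> = real (card ?K) * (\<Sum>F\<in>?H. bin_deviation c Q n m F)"
    by (simp add: sum_distrib_left)
  also have "\<dots> \<le> real (card ?K) * (real (card ?H) * ?bd)"
    by (intro mult_left_mono average_bin_deviation[OF c m(1) \<tau>]) auto
  also have "\<dots> = real (card (?H \<times> ?K)) * ?bd"
    by (simp add: card_cartesian_product)
  finally have d: "(\<Sum>h\<in>?H \<times> ?K. bin_deviation c Q n m (fst h)) \<le> real (card (?H \<times> ?K)) * ?bd" .
  have "(\<Sum>h\<in>?H \<times> ?K. collision_prob p prj_w prj_u \<alpha> n (?hf h) + collision_prob p prj_w prj_v \<beta> n (?hf h)
      + 2 * bin_deviation c Q n m (fst h)) \<le> real (card (?H \<times> ?K)) * (?bu + ?bv + 2 * ?bd)"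
    using u v d by (simp only: sum.distrib sum_distrib_left[symmetric] distrib_left)
  then have "\<exists>h\<in>?H \<times> ?K. collision_prob p prj_w prj_u \<alpha> n (?hf h) + collision_prob p prj_w prj_v \<beta> n (?hf h)
      + 2 * bin_deviation c Q n m (fst h) \<le> ?bu + ?bv + 2 * ?bd"
    using uni by (intro exists_le_average) (auto simp: universal_hash_def)
  then show ?thesis by auto
qed

text \<open>Each receiver first recovers the block of W and then uses it as further side information
  for its own source. The hashes \<open>Kx\<close> and \<open>Ky\<close> can be picked separately,
  because each enters only one collision probability.\<close>

lemma block_code:
  fixes Q :: "('x::finite \<times> 'y::finite \<times> 'u::finite \<times> 'v::finite) pmf" and c :: "'x \<Rightarrow> 'y \<Rightarrow> 'w::finite \<Rightarrow> real"
  assumes c: "c \<in> cond_kernels" and m: "1 \<le> m" "1 \<le> m0" "1 \<le> m1" "1 \<le> m2" and \<tau>: "0 \<le> \<tau>"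
  defines "p \<equiv> joint_p c Q"
  shows "\<exists>e dx dy. is_code n m0 m1 m2 e \<and> err_x Q n e dx + err_y Q n e dy
    \<le> (atypical_prob p prj_w prj_u \<alpha>u n + 2 powr (real n * \<alpha>u) / (real m * real m0))
      + (atypical_prob p prj_w prj_v \<alpha>v n + 2 powr (real n * \<alpha>v) / (real m * real m0))
      + 2 * (2 * heavy_prob c Q \<tau> n + sqrt ((real m - 1) * \<tau>))
      + (atypical_prob p prj_x prj_wu \<beta>x n + 2 powr (real n * \<beta>x) / real m1)
      + (atypical_prob p prj_y prj_wv \<beta>y n + 2 powr (real n * \<beta>y) / real m2)"
    (is "\<exists>e dx dy. _ \<and> _ \<le> ?buv + ?bx + ?by")
proof -
  have p: "0 \<le> p j" "(\<Sum>j\<in>UNIV. p j) = 1" for j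
    using c by (auto simp: p_def joint_p_nonneg sum_joint_p)
  obtain F G where F: "F \<in> blocks n \<rightarrow>\<^sub>E {1..m}" and G: "G \<in> blocks n \<rightarrow>\<^sub>E {1..m0}"
    and FG: "collision_prob p prj_w prj_u \<alpha>u n (\<lambda>w. (F w, G w)) + collision_prob p prj_w prj_v \<alpha>v n (\<lambda>w. (F w, G w))
      + 2 * bin_deviation c Q n m F \<le> ?buv"
    using exists_double_binning[OF c m(1,2) \<tau>, of n Q \<alpha>u \<alpha>v] unfolding p_def by blast
  obtain Kx where Kx: "Kx \<in> blocks n \<rightarrow>\<^sub>E {1..m1}" "collision_prob p prj_x prj_wu \<beta>x n Kx \<le> ?bx"
    using exists_binning[OF p m(3), of n prj_x prj_wu \<beta>x] by blast
  obtain Ky where Ky: "Ky \<in> blocks n \<rightarrow>\<^sub>E {1..m2}" "collision_prob p prj_y prj_wv \<beta>y n Ky \<le> ?by"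
    using exists_binning[OF p m(4), of n prj_y prj_wv \<beta>y] by blast
  define dx where "dx f a b us = bin_decoder Kx (typical_set p prj_x prj_wu \<beta>x n) (blocks n) b
      (zip (bin_decoder (\<lambda>w. (F w, G w)) (typical_set p prj_w prj_u \<alpha>u n) (blocks n) (f, a) us) us)" for f a b us
  define dy where "dy f a b vs = bin_decoder Ky (typical_set p prj_y prj_wv \<beta>y n) (blocks n) b
      (zip (bin_decoder (\<lambda>w. (F w, G w)) (typical_set p prj_w prj_v \<alpha>v n) (blocks n) (f, a) vs) vs)" for f a b vs
  \<comment> \<open>Adding both error indicators lets one choice of f and of the encoder serve both
    receivers. This is where the bound 2 on the cost comes from.\<close>
  define cost where "cost w f zs = (if dx f (G w) (Kx (seq_x zs)) (seq_u zs) \<noteq> seq_x zs then 1 else 0)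
      + (if dy f (G w) (Ky (seq_y zs)) (seq_v zs) \<noteq> seq_y zs then 1 else (0::real))" for w f zs
  have "\<exists>f enc. (\<forall>z. enc z \<in> blocks n) \<and> (\<Sum>zs\<in>blocks n. iid_prob Q zs * cost (enc (seq_x zs, seq_y zs)) f zs)
    \<le> (\<Sum>zs\<in>blocks n. \<Sum>w\<in>blocks n. iid_prob Q zs * block_kernel c (seq_x zs, seq_y zs) w * cost w (F w) zs)
      + 2 * bin_deviation c Q n m F"
    unfolding bin_deviation_def
    by (rule fix_shared_randomness[where Z = "\<lambda>zs. (seq_x zs, seq_y zs)"])
      (use F m in \<open>auto simp: cost_def iid_prob_nonneg block_kernel_nonneg[OF c] PiE_iff Ex_list_of_length\<close>)
  then obtain f enc where enc: "\<And>z. enc z \<in> blocks n"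
    and le: "(\<Sum>zs\<in>blocks n. iid_prob Q zs * cost (enc (seq_x zs, seq_y zs)) f zs)
    \<le> (\<Sum>zs\<in>blocks n. \<Sum>w\<in>blocks n. iid_prob Q zs * block_kernel c (seq_x zs, seq_y zs) w * cost w (F w) zs)
      + 2 * bin_deviation c Q n m F" by blast
  let ?cu = "\<lambda>js. collides (\<lambda>w. (F w, G w)) (typical_set p prj_w prj_u \<alpha>u n) (blocks n) (map prj_w js) (map prj_u js)"
  let ?cv = "\<lambda>js. collides (\<lambda>w. (F w, G w)) (typical_set p prj_w prj_v \<alpha>v n) (blocks n) (map prj_w js) (map prj_v js)"
  let ?cx = "\<lambda>js. collides Kx (typical_set p prj_x prj_wu \<beta>x n) (blocks n) (map prj_x js) (map prj_wu js)"
  let ?cy = "\<lambda>js. collides Ky (typical_set p prj_y prj_wv \<beta>y n) (blocks n) (map prj_y js) (map prj_wv js)"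
  \<comment> \<open>With \<open>f = F w\<close>, as under the ideal law, both decoding stages are
    correct unless one of their two collision events occurs.\<close>
  have cost_le: "cost w (F w) zs \<le> (if ?cu (zip w zs) then 1 else 0) + (if ?cx (zip w zs) then 1 else 0)
      + ((if ?cv (zip w zs) then 1 else 0) + (if ?cy (zip w zs) then 1 else 0))"
    if len: "length zs = n" "length w = n" for w zs
  proof -
    have wz: "length w = length zs" using len by simp
    have "dx (F w) (G w) (Kx (seq_x zs)) (seq_u zs) = seq_x zs" if "\<not> ?cu (zip w zs)" "\<not> ?cx (zip w zs)"
    proof -
      have "bin_decoder (\<lambda>w. (F w, G w)) (typical_set p prj_w prj_u \<alpha>u n) (blocks n) (F w, G w) (seq_u zs) = w"
        by (rule bin_decoder_eq[where h = "\<lambda>w. (F w, G w)" and a = w]) (use that(1) len in \<open>simp_all only: map_prj_zip[OF wz] mem_Collect_eq not_False_eq_True\<close>)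
      moreover have "bin_decoder Kx (typical_set p prj_x prj_wu \<beta>x n) (blocks n) (Kx (seq_x zs)) (zip w (seq_u zs)) = seq_x zs"
        by (rule bin_decoder_eq) (use that(2) len in \<open>simp_all only: map_prj_zip[OF wz] mem_Collect_eq not_False_eq_True length_map\<close>)
      ultimately show ?thesis by (simp add: dx_def)
    qed
    moreover have "dy (F w) (G w) (Ky (seq_y zs)) (seq_v zs) = seq_y zs" if "\<not> ?cv (zip w zs)" "\<not> ?cy (zip w zs)"
    proof -
      have "bin_decoder (\<lambda>w. (F w, G w)) (typical_set p prj_w prj_v \<alpha>v n) (blocks n) (F w, G w) (seq_v zs) = w"
        by (rule bin_decoder_eq[where h = "\<lambda>w. (F w, G w)" and a = w]) (use that(1) len in \<open>simp_all only: map_prj_zip[OF wz] mem_Collect_eq not_False_eq_True\<close>)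
      moreover have "bin_decoder Ky (typical_set p prj_y prj_wv \<beta>y n) (blocks n) (Ky (seq_y zs)) (zip w (seq_v zs)) = seq_y zs"
        by (rule bin_decoder_eq) (use that(2) len in \<open>simp_all only: map_prj_zip[OF wz] mem_Collect_eq not_False_eq_True length_map\<close>)
      ultimately show ?thesis by (simp add: dy_def)
    qed
    ultimately show ?thesis unfolding cost_def by (intro add_mono) auto
  qed
  have "(\<Sum>zs\<in>blocks n. \<Sum>w\<in>blocks n. iid_prob Q zs * block_kernel c (seq_x zs, seq_y zs) w * cost w (F w) zs)
      \<le> (\<Sum>zs\<in>blocks n. \<Sum>w\<in>blocks n. iid_weight p (zip w zs) *
        ((if ?cu (zip w zs) then 1 else 0) + (if ?cx (zip w zs) then 1 else 0)
      + ((if ?cv (zip w zs) then 1 else 0) + (if ?cy (zip w zs) then 1 else 0))))"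
  proof (intro sum_mono)
    fix zs :: "('x \<times> 'y \<times> 'u \<times> 'v) list" and w :: "'w list"
    assume zs: "zs \<in> blocks n" and w: "w \<in> blocks n"
    then have eq: "iid_prob Q zs * block_kernel c (seq_x zs, seq_y zs) w = iid_weight p (zip w zs)"
      unfolding p_def by (intro iid_weight_joint_p[symmetric]) simp
    show "iid_prob Q zs * block_kernel c (seq_x zs, seq_y zs) w * cost w (F w) zs
        \<le> iid_weight p (zip w zs) *
        ((if ?cu (zip w zs) then 1 else 0) + (if ?cx (zip w zs) then 1 else 0)
      + ((if ?cv (zip w zs) then 1 else 0) + (if ?cy (zip w zs) then 1 else 0)))"
      unfolding eq by (intro mult_left_mono cost_le iid_weight_nonneg p) (use zs w in auto)
  qed
  also have "\<dots> = (\<Sum>js\<in>blocks n. iid_weight p js * ((if ?cu js then 1 else 0) + (if ?cx js then 1 else 0)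
      + ((if ?cv js then 1 else 0) + (if ?cy js then 1 else 0))))"
    by (rule sum_blocks_zip[symmetric])
  also have "\<dots> = (\<Sum>js\<in>blocks n. (if ?cu js then iid_weight p js else 0) + (if ?cx js then iid_weight p js else 0)
      + ((if ?cv js then iid_weight p js else 0) + (if ?cy js then iid_weight p js else 0)))"
    by (intro sum.cong refl) (simp add: distrib_left)
  also have "\<dots> = collision_prob p prj_w prj_u \<alpha>u n (\<lambda>w. (F w, G w)) + collision_prob p prj_x prj_wu \<beta>x n Kx
      + (collision_prob p prj_w prj_v \<alpha>v n (\<lambda>w. (F w, G w)) + collision_prob p prj_y prj_wv \<beta>y n Ky)"
    unfolding collision_prob_def sum.inter_filter[OF finite_blocks] by (simp only: sum.distrib)
  finally have ideal: "(\<Sum>zs\<in>blocks n. \<Sum>w\<in>blocks n. iid_prob Q zs * block_kernel c (seq_x zs, seq_y zs) w * cost w (F w) zs)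
      \<le> collision_prob p prj_w prj_u \<alpha>u n (\<lambda>w. (F w, G w)) + collision_prob p prj_x prj_wu \<beta>x n Kx
      + (collision_prob p prj_w prj_v \<alpha>v n (\<lambda>w. (F w, G w)) + collision_prob p prj_y prj_wv \<beta>y n Ky)" .
  \<comment> \<open>Only the common message depends on the chosen block of W, and through G alone; f
    has become a constant of the decoders.\<close>
  define e where "e xs ys = (G (enc (xs, ys)), Kx xs, Ky ys)" for xs ys
  have code: "is_code n m0 m1 m2 e"
    using G Kx(1) Ky(1) enc unfolding is_code_def e_def by (auto simp: PiE_iff)
  have "err_x Q n e (dx f) + err_y Q n e (dy f) = (\<Sum>zs\<in>blocks n. iid_prob Q zs * cost (enc (seq_x zs, seq_y zs)) f zs)"
    unfolding err_x_def err_y_def sum.distrib[symmetric] e_def Let_def cost_def by (intro sum.cong refl) simp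
  also have "\<dots> \<le> ?buv + ?bx + ?by"
    using le ideal FG Kx(2) Ky(2) by linarith
  finally show ?thesis using code by blast
qed

section \<open>Achievable rates\<close>

text \<open>The conditional entropy H(W|X,Y), written through the kernel because
  \<open>heavy_prob\<close> compares kernel values with a threshold.\<close>

definition kernel_ent :: "('x \<Rightarrow> 'y \<Rightarrow> 'w::finite \<Rightarrow> real) \<Rightarrow> ('x::finite \<times> 'y::finite \<times> 'u::finite \<times> 'v::finite) pmf \<Rightarrow> real" where
  "kernel_ent c Q = - (\<Sum>j\<in>UNIV. joint_p c Q j * log 2 ((\<lambda>(w, x, y, uv). c x y w) j))"

lemma heavy_prob_tendsto_0:
  fixes Q :: "('x::finite \<times> 'y::finite \<times> 'u::finite \<times> 'v::finite) pmf" and c :: "'x \<Rightarrow> 'y \<Rightarrow> 'w::finite \<Rightarrow> real"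
  assumes c: "c \<in> cond_kernels" and \<beta>: "\<beta> < kernel_ent c Q"
  shows "(\<lambda>n. heavy_prob c Q (2 powr (- real n * \<beta>)) n) \<longlonglongrightarrow> 0"
proof -
  let ?p = "joint_p c Q" and ?k = "\<lambda>(w, x, y, uv). c x y w"
  let ?W = "\<lambda>n. \<Sum>js\<in>{js \<in> blocks n. real n * (- \<beta>) < (\<Sum>j\<leftarrow>js. log 2 (?k j))}. iid_weight ?p js"
  have p: "0 \<le> ?p j" "(\<Sum>j\<in>UNIV. ?p j) = 1" for j
    using c by (auto simp: joint_p_nonneg sum_joint_p)
  have W: "?W \<longlonglongrightarrow> 0"
    by (rule weak_law[OF p]) (use \<beta> in \<open>simp add: kernel_ent_def\<close>)
  have heavy: "real n * (- \<beta>) < (\<Sum>j\<leftarrow>js. log 2 (?k j))"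
    if js: "2 powr (- real n * \<beta>) < iid_weight ?k js" "iid_weight ?p js \<noteq> 0" for js n
  proof -
    have "0 < ?k j" if "j \<in> set js" for j
    proof -
      have "?p j \<noteq> 0" using js(2) that by (auto simp: iid_weight_eq_0_iff)
      then have "?k j \<noteq> 0" by (auto simp: joint_p_def split: prod.splits)
      moreover have "0 \<le> ?k j" using c by (auto simp: cond_kernels_nonneg split: prod.splits)
      ultimately show ?thesis by simp
    qed
    then have "log 2 (iid_weight ?k js) = (\<Sum>j\<leftarrow>js. log 2 (?k j))"
      by (rule log_iid_weight)
    moreover have "log 2 (2 powr (- real n * \<beta>)) < log 2 (iid_weight ?k js)"
      using js(1) by (intro log_less) auto
    ultimately show ?thesis by simp
  qed
  have "heavy_prob c Q (2 powr (- real n * \<beta>)) n \<le> ?W n" for n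
    unfolding heavy_prob_def sum.inter_filter[OF finite_blocks]
  proof (rule sum_mono)
    fix js
    show "(if 2 powr (- real n * \<beta>) < iid_weight ?k js then iid_weight ?p js else 0)
        \<le> (if real n * (- \<beta>) < (\<Sum>j\<leftarrow>js. log 2 (?k j)) then iid_weight ?p js else 0)"
      using heavy[of n js] iid_weight_nonneg[of ?p js] p by auto
  qed
  moreover have "0 \<le> heavy_prob c Q (2 powr (- real n * \<beta>)) n" for n
    unfolding heavy_prob_def using p by (intro sum_nonneg) (auto simp: iid_weight_nonneg)
  ultimately show ?thesis
    by (intro tendsto_sandwich[OF _ _ tendsto_const W] always_eventually) auto
qed

text \<open>By symmetry of mutual information the left side is H(W|S) - H(W|X,Y,S). The joint law of
  (X,Y,W,S) is the kernel times the law of (X,Y,S), so its logarithm splits and H(W|X,Y,S) reduces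
  to the entropy of the kernel.\<close>

lemma cmi_joint_p:
  fixes Q :: "('x::finite \<times> 'y::finite \<times> 'u::finite \<times> 'v::finite) pmf" and c :: "'x \<Rightarrow> 'y \<Rightarrow> 'w::finite \<Rightarrow> real"
    and S :: "'w \<times> 'x \<times> 'y \<times> 'u \<times> 'v \<Rightarrow> 's"
  assumes c: "c \<in> cond_kernels" and S: "\<And>w x y uv. S (w, x, y, uv) = r uv"
  shows "cmi (joint_p c Q) (\<lambda>(w, x, y, u, v). (x, y)) prj_w S = cent (joint_p c Q) prj_w S - kernel_ent c Q"
proof -
  let ?p = "joint_p c Q" and ?Z = "\<lambda>(w, x, y, u, v). (x, y)" and ?k = "\<lambda>(w, x, y, uv). c x y w"
  let ?A = "\<lambda>x y t. \<Sum>uv\<in>{uv. r uv = t}. pmf Q (x, y, uv)"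
  have mZWS: "marg ?p (\<lambda>j. (?Z j, prj_w j, S j)) ((x, y), w, t) = c x y w * ?A x y t" for x y w t
  proof -
    have "{j. (?Z j, prj_w j, S j) = ((x, y), w, t)} = (\<lambda>uv. (w, x, y, uv)) ` {uv. r uv = t}"
      using S by force
    then show ?thesis
      by (simp add: marg_def sum.reindex inj_on_def joint_p_def sum_distrib_left case_prod_unfold)
  qed
  have mZS: "marg ?p (\<lambda>j. (?Z j, S j)) ((x, y), t) = ?A x y t" for x y t
  proof -
    have "{j. (?Z j, S j) = ((x, y), t)} = (\<lambda>(w, uv). (w, x, y, uv)) ` (UNIV \<times> {uv. r uv = t})"
      using S by force
    then have "marg ?p (\<lambda>j. (?Z j, S j)) ((x, y), t) = (\<Sum>(w, uv)\<in>UNIV \<times> {uv. r uv = t}. c x y w * pmf Q (x, y, uv))"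
      by (simp add: marg_def sum.reindex inj_on_def joint_p_def case_prod_unfold)
    also have "\<dots> = (\<Sum>w\<in>UNIV. c x y w) * ?A x y t"
      by (simp add: sum.cartesian_product[symmetric] sum_product)
    finally show ?thesis using c by (simp add: cond_kernels_sum)
  qed
  have "ent ?p (\<lambda>j. (?Z j, prj_w j, S j)) - ent ?p (\<lambda>j. (?Z j, S j)) = kernel_ent c Q"
    unfolding ent_eq_expectation kernel_ent_def
  proof -
    have "?p j * log 2 (marg ?p (\<lambda>j. (?Z j, prj_w j, S j)) (?Z j, prj_w j, S j))
        = ?p j * log 2 (?k j) + ?p j * log 2 (marg ?p (\<lambda>j. (?Z j, S j)) (?Z j, S j))" for j
    proof (cases "?p j = 0")
      case False
      obtain w x y uv where j: "j = (w, x, y, uv)" by (metis surj_pair)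
      have "0 < ?p j" using False joint_p_nonneg[OF c, of Q j] by simp
      then have "0 < marg ?p (\<lambda>j. (?Z j, prj_w j, S j)) (?Z j, prj_w j, S j)"
        using marg_pos[of ?p j "\<lambda>j. (?Z j, prj_w j, S j)", OF joint_p_nonneg[OF c]] by simp
      then have "c x y w * ?A x y (r uv) > 0"
        using mZWS[of x y w "r uv"] S by (simp add: j case_prod_unfold)
      then have "c x y w \<noteq> 0" "?A x y (r uv) \<noteq> 0" by auto
      then show ?thesis
        using mZWS[of x y w "r uv"] mZS[of x y "r uv"] S
        by (simp add: j case_prod_unfold log_mult distrib_left)
    qed simp
    then show "- (\<Sum>j\<in>UNIV. ?p j * log 2 (marg ?p (\<lambda>j. (?Z j, prj_w j, S j)) (?Z j, prj_w j, S j)))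
        - - (\<Sum>j\<in>UNIV. ?p j * log 2 (marg ?p (\<lambda>j. (?Z j, S j)) (?Z j, S j)))
        = - (\<Sum>j\<in>UNIV. ?p j * log 2 (?k j))"
      by (simp add: sum.distrib)
  qed
  then show ?thesis by (simp add: cmi_def cent_def)
qed

lemma nat_ceiling_powr:
  fixes x :: real
  shows "1 \<le> nat \<lceil>2 powr x\<rceil>" and "2 powr x \<le> real (nat \<lceil>2 powr x\<rceil>)"
    and "real (nat \<lceil>2 powr x\<rceil>) - 1 \<le> 2 powr x"
    and "0 \<le> x \<Longrightarrow> log 2 (real (nat \<lceil>2 powr x\<rceil>)) \<le> x + 1"
proof -
  have pos: "0 < \<lceil>2 powr x\<rceil>" by simp
  then show 1: "1 \<le> nat \<lceil>2 powr x\<rceil>" by linarith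
  have eq: "real (nat \<lceil>2 powr x\<rceil>) = of_int \<lceil>2 powr x\<rceil>" using pos by (simp add: less_imp_le)
  show "2 powr x \<le> real (nat \<lceil>2 powr x\<rceil>)" unfolding eq by linarith
  show 3: "real (nat \<lceil>2 powr x\<rceil>) - 1 \<le> 2 powr x" unfolding eq by linarith
  show "log 2 (real (nat \<lceil>2 powr x\<rceil>)) \<le> x + 1" if "0 \<le> x"
  proof -
    have "1 \<le> 2 powr x" using that by (simp add: ge_one_powr_ge_zero)
    moreover have "2 powr (x + 1) = 2 * 2 powr x" by (simp add: powr_add)
    ultimately have "real (nat \<lceil>2 powr x\<rceil>) \<le> 2 powr (x + 1)" using 3 by linarith
    then have "log 2 (real (nat \<lceil>2 powr x\<rceil>)) \<le> log 2 (2 powr (x + 1))"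
      using 1 by (intro log_mono) auto
    then show ?thesis by simp
  qed
qed

text \<open>Rounding up costs at most one bit per block, hence at most d per letter once n is at
  least \<open>1 / d\<close>. For negative R this could fail, since the rounded size is never below
  1.\<close>

lemma rate_bound:
  assumes "0 \<le> R" and "0 < d" and "1 / d \<le> real n"
  shows "log 2 (real (nat \<lceil>2 powr (real n * R)\<rceil>)) / real n \<le> R + d"
proof -
  have n: "0 < real n" using assms by (meson divide_pos_pos less_le_trans zero_less_one)
  have "log 2 (real (nat \<lceil>2 powr (real n * R)\<rceil>)) \<le> real n * R + 1"
    using assms by (intro nat_ceiling_powr(4)) auto
  moreover have "1 \<le> d * real n" using assms by (simp add: divide_simps mult.commute)
  ultimately have "log 2 (real (nat \<lceil>2 powr (real n * R)\<rceil>)) \<le> (R + d) * real n"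
    by (simp add: algebra_simps)
  then show ?thesis using n by (simp add: divide_le_eq)
qed

lemma err_x_nonneg: "0 \<le> err_x Q n e dx"
  unfolding err_x_def by (intro sum_nonneg) (auto simp: iid_prob_nonneg Let_def split: prod.split)

lemma err_y_nonneg: "0 \<le> err_y Q n e dy"
  unfolding err_y_def by (intro sum_nonneg) (auto simp: iid_prob_nonneg Let_def split: prod.split)

lemma Rin_p_achievable:
  fixes Q :: "('x::finite \<times> 'y::finite \<times> 'u::finite \<times> 'v::finite) pmf" and c :: "'x \<Rightarrow> 'y \<Rightarrow> 'w::finite \<Rightarrow> real"
  assumes c: "c \<in> cond_kernels" and R: "(R0, R1, R2) \<in> Rin_p (joint_p c Q)"
  shows "achievable Q (R0, R1, R2)"
  unfolding achievable_def prod.case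
proof (intro allI impI)
  fix \<epsilon> :: real assume \<epsilon>: "0 < \<epsilon>"
  \<comment> \<open>The largest excess is that of the common message: 4 d in its exponent and one d
    for rounding, in total 5 d.\<close>
  define d where "d = \<epsilon> / 8"
  have d: "0 < d" "5 * d \<le> \<epsilon>" using \<epsilon> by (auto simp: d_def)
  let ?p = "joint_p c Q"
  define h where "h = kernel_ent c Q"
  define hu where "hu = cent ?p prj_w prj_u"
  define hv where "hv = cent ?p prj_w prj_v"
  have p: "0 \<le> ?p j" "(\<Sum>j\<in>UNIV. ?p j) = 1" for j
    using c by (auto simp: joint_p_nonneg sum_joint_p)
  have cu: "cmi ?p (\<lambda>(w, x, y, u, v). (x, y)) prj_w prj_u = hu - h"
    unfolding hu_def h_def by (rule cmi_joint_p[OF c, where r = fst]) (simp add: case_prod_unfold)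
  have cv: "cmi ?p (\<lambda>(w, x, y, u, v). (x, y)) prj_w prj_v = hv - h"
    unfolding hv_def h_def by (rule cmi_joint_p[OF c, where r = snd]) (simp add: case_prod_unfold)
  have "0 \<le> hu - h" unfolding cu[symmetric] using p by (rule cmi_nonneg)
  moreover have R0: "hu - h \<le> R0" "hv - h \<le> R0"
    and R1: "cent ?p prj_x prj_wu \<le> R1" and R2: "cent ?p prj_y prj_wv \<le> R2"
    using R unfolding Rin_p_def by (auto simp: cu cv)
  ultimately have Rnn: "0 \<le> R0" "0 \<le> R1" "0 \<le> R2"
    using cent_nonneg[of ?p prj_x prj_wu, OF p(1)] cent_nonneg[of ?p prj_y prj_wv, OF p(1)] by linarith+
  define M where "M r n = nat \<lceil>2 powr (real n * r)\<rceil>" for r :: real and n :: nat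
  have M: "1 \<le> M r n" "2 powr (real n * r) \<le> real (M r n)" "real (M r n) - 1 \<le> 2 powr (real n * r)" for r n
    unfolding M_def by (rule nat_ceiling_powr)+
  define q where "q n = 2 powr (- real n * d)" for n :: nat
  define B where "B n = (atypical_prob ?p prj_w prj_u (hu + d) n + q n) + (atypical_prob ?p prj_w prj_v (hv + d) n + q n)
      + 2 * (2 * heavy_prob c Q (2 powr (- real n * (h - d))) n + sqrt (q n))
      + (atypical_prob ?p prj_x prj_wu (R1 + d) n + q n) + (atypical_prob ?p prj_y prj_wv (R2 + d) n + q n)" for n
  have q0: "q \<longlonglongrightarrow> 0"
  proof -
    have "(\<lambda>n. (2 powr (- d)) ^ n) \<longlonglongrightarrow> 0"
      using d by (intro LIMSEQ_realpow_zero) (auto simp: powr_less_one)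
    also have "(\<lambda>n. (2 powr (- d)) ^ n) = q"
      by (simp add: q_def fun_eq_iff powr_realpow[symmetric] powr_powr mult.commute)
    finally show ?thesis .
  qed
  have "B \<longlonglongrightarrow> (0 + 0) + (0 + 0) + 2 * (2 * 0 + sqrt 0) + (0 + 0) + (0 + 0)"
    unfolding B_def atypical_prob_def
    by (intro tendsto_intros q0 atypical_tendsto_0 heavy_prob_tendsto_0 c p)
      (use d R1 R2 in \<open>auto simp: hu_def hv_def h_def\<close>)
  then have "B \<longlonglongrightarrow> 0" by simp
  then have "\<forall>\<^sub>F n in sequentially. B n < \<epsilon>" using \<epsilon> by (rule order_tendstoD)
  then obtain N where N: "\<And>n. N \<le> n \<Longrightarrow> B n < \<epsilon>" by (auto simp: eventually_sequentially)
  show "\<exists>N. \<forall>n\<ge>N. \<exists>m0 m1 m2 e (dx :: nat \<Rightarrow> nat \<Rightarrow> 'u list \<Rightarrow> 'x list) (dy :: nat \<Rightarrow> nat \<Rightarrow> 'v list \<Rightarrow> 'y list).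
      is_code n m0 m1 m2 e \<and> max (err_x Q n e dx) (err_y Q n e dy) \<le> \<epsilon> \<and>
      log 2 (real m0) / real n \<le> R0 + \<epsilon> \<and> log 2 (real m1) / real n \<le> R1 + \<epsilon> \<and> log 2 (real m2) / real n \<le> R2 + \<epsilon>"
  proof (rule exI[of _ "max N (nat \<lceil>1 / d\<rceil>)"], intro allI impI)
    fix n :: nat assume n: "max N (nat \<lceil>1 / d\<rceil>) \<le> n"
    then have nN: "N \<le> n" and nd: "1 / d \<le> real n" by (auto simp: nat_le_iff ceiling_le_iff)
    \<comment> \<open>The exponents leave a gap of at least d everywhere. \<open>F\<close> stays d
      below the heaviness threshold h - d, and the joint rate h + R0 + 2 d of \<open>(F,G)\<close>
      is at least d above hu + d and hv + d. The private hashes lie d above their typicality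
      thresholds. Every exponential term is therefore at most \<open>q n\<close>.\<close>
    let ?mf = "M (h - 2 * d) n" and ?ma = "M (R0 + 4 * d) n" and ?mb = "M (R1 + 2 * d) n" and ?mc = "M (R2 + 2 * d) n"
    have div_le: "2 powr (real n * a) / y \<le> q n" if "2 powr (real n * b) \<le> y" "a + d \<le> b" for a b y
    proof -
      have y: "0 < y" using that(1) powr_gt_zero[of 2 "real n * b"] by linarith
      have "real n * a \<le> - real n * d + real n * b"
        using mult_left_mono[OF that(2), of "real n"] by (simp add: algebra_simps)
      then have "2 powr (real n * a) \<le> q n * 2 powr (real n * b)"
        unfolding q_def powr_add[symmetric] by (intro powr_mono) auto
      also have "\<dots> \<le> q n * y" using that(1) by (intro mult_left_mono) (auto simp: q_def)
      finally show ?thesis using y by (simp add: divide_le_eq)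
    qed
    have mm0: "2 powr (real n * (h - 2 * d + (R0 + 4 * d))) \<le> real ?mf * real ?ma"
      unfolding distrib_left[of "real n" "h - 2 * d"] powr_add
      by (rule mult_mono[OF M(2) M(2)]) auto
    have u: "2 powr (real n * (hu + d)) / (real ?mf * real ?ma) \<le> q n"
      by (rule div_le[OF mm0]) (use R0 in simp)
    have v: "2 powr (real n * (hv + d)) / (real ?mf * real ?ma) \<le> q n"
      by (rule div_le[OF mm0]) (use R0 in simp)
    have x: "2 powr (real n * (R1 + d)) / real ?mb \<le> q n" by (rule div_le[OF M(2)]) simp
    have y: "2 powr (real n * (R2 + d)) / real ?mc \<le> q n" by (rule div_le[OF M(2)]) simp
    \<comment> \<open>With \<open>?mf\<close> in place of \<open>?mf - 1\<close> the rounding would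
      add \<open>2 powr (- n * (h - d))\<close>, which does not vanish when h is at most d, for
      instance when W is a function of (X,Y).\<close>
    have "(real ?mf - 1) * 2 powr (- real n * (h - d)) \<le> 2 powr (real n * (h - 2 * d)) * 2 powr (- real n * (h - d))"
      by (intro mult_right_mono M) auto
    also have "\<dots> = q n" unfolding q_def powr_add[symmetric] by (simp add: algebra_simps)
    finally have s: "sqrt ((real ?mf - 1) * 2 powr (- real n * (h - d))) \<le> sqrt (q n)" by simp
    obtain e dx dy where code: "is_code n ?ma ?mb ?mc e" and err: "err_x Q n e dx + err_y Q n e dy
      \<le> (atypical_prob ?p prj_w prj_u (hu + d) n + 2 powr (real n * (hu + d)) / (real ?mf * real ?ma))
      + (atypical_prob ?p prj_w prj_v (hv + d) n + 2 powr (real n * (hv + d)) / (real ?mf * real ?ma))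
      + 2 * (2 * heavy_prob c Q (2 powr (- real n * (h - d))) n + sqrt ((real ?mf - 1) * 2 powr (- real n * (h - d))))
      + (atypical_prob ?p prj_x prj_wu (R1 + d) n + 2 powr (real n * (R1 + d)) / real ?mb)
      + (atypical_prob ?p prj_y prj_wv (R2 + d) n + 2 powr (real n * (R2 + d)) / real ?mc)"
      using block_code[where n = n and Q = Q and \<tau> = "2 powr (- real n * (h - d))"
          and \<alpha>u = "hu + d" and \<alpha>v = "hv + d" and \<beta>x = "R1 + d" and \<beta>y = "R2 + d",
          OF c M(1)[of "h - 2 * d" n] M(1)[of "R0 + 4 * d" n] M(1)[of "R1 + 2 * d" n] M(1)[of "R2 + 2 * d" n] powr_ge_zero]
      by blast
    have "err_x Q n e dx + err_y Q n e dy \<le> B n"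
      unfolding B_def by (rule order_trans[OF err]) (intro add_mono mult_left_mono u v x y s order_refl, simp)
    then have "max (err_x Q n e dx) (err_y Q n e dy) \<le> \<epsilon>"
      using N[OF nN] err_x_nonneg[of Q n e dx] err_y_nonneg[of Q n e dy] by linarith
    moreover have "log 2 (real ?ma) / real n \<le> R0 + \<epsilon>"
      using rate_bound[of "R0 + 4 * d" d n] Rnn d nd unfolding M_def by linarith
    moreover have "log 2 (real ?mb) / real n \<le> R1 + \<epsilon>"
      using rate_bound[of "R1 + 2 * d" d n] Rnn d nd unfolding M_def by linarith
    moreover have "log 2 (real ?mc) / real n \<le> R2 + \<epsilon>"
      using rate_bound[of "R2 + 2 * d" d n] Rnn d nd unfolding M_def by linarith
    ultimately show "\<exists>m0 m1 m2 e (dx :: nat \<Rightarrow> nat \<Rightarrow> 'u list \<Rightarrow> 'x list) (dy :: nat \<Rightarrow> nat \<Rightarrow> 'v list \<Rightarrow> 'y list).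
      is_code n m0 m1 m2 e \<and> max (err_x Q n e dx) (err_y Q n e dy) \<le> \<epsilon> \<and>
      log 2 (real m0) / real n \<le> R0 + \<epsilon> \<and> log 2 (real m1) / real n \<le> R1 + \<epsilon> \<and> log 2 (real m2) / real n \<le> R2 + \<epsilon>"
      using code by blast
  qed
qed

text \<open>The slack \<epsilon> in the definition of achievability is split: half covers the
  distance to a nearby achievable triple, half is spent on the code for that triple.\<close>

lemma closed_achievable: "closed {R. achievable Q R}"
  unfolding closure_subset_eq[symmetric]
proof
  fix R assume cl: "R \<in> closure {R. achievable Q R}"
  obtain R0 R1 R2 where R: "R = (R0, R1, R2)" by (metis surj_pair)
  show "R \<in> {R. achievable Q R}"
    unfolding mem_Collect_eq R unfolding achievable_def prod.case
  proof (intro allI impI)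
    fix \<epsilon> :: real assume \<epsilon>: "0 < \<epsilon>"
    then obtain S where S: "achievable Q S" "dist S R < \<epsilon> / 2"
      using cl unfolding closure_approachable by (metis half_gt_zero mem_Collect_eq)
    obtain S0 S1 S2 where S': "S = (S0, S1, S2)" by (metis surj_pair)
    have "dist S0 R0 < \<epsilon> / 2" "dist S1 R1 < \<epsilon> / 2" "dist S2 R2 < \<epsilon> / 2"
      using S(2) dist_fst_le[of S R] dist_snd_le[of S R] dist_fst_le[of "snd S" "snd R"] dist_snd_le[of "snd S" "snd R"]
      unfolding S' R by auto
    then have le: "S0 + \<epsilon> / 2 \<le> R0 + \<epsilon>" "S1 + \<epsilon> / 2 \<le> R1 + \<epsilon>" "S2 + \<epsilon> / 2 \<le> R2 + \<epsilon>"
      by (auto simp: dist_real_def abs_if split: if_splits)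
    obtain N where N: "\<forall>n\<ge>N. \<exists>m0 m1 m2 e dx dy. is_code n m0 m1 m2 e \<and>
        max (err_x Q n e dx) (err_y Q n e dy) \<le> \<epsilon> / 2 \<and>
        log 2 (real m0) / real n \<le> S0 + \<epsilon> / 2 \<and> log 2 (real m1) / real n \<le> S1 + \<epsilon> / 2 \<and>
        log 2 (real m2) / real n \<le> S2 + \<epsilon> / 2"
      using S(1) \<epsilon> half_gt_zero unfolding S' achievable_def prod.case by blast
    show "\<exists>N. \<forall>n\<ge>N. \<exists>m0 m1 m2 e dx dy. is_code n m0 m1 m2 e \<and>
        max (err_x Q n e dx) (err_y Q n e dy) \<le> \<epsilon> \<and>
        log 2 (real m0) / real n \<le> R0 + \<epsilon> \<and> log 2 (real m1) / real n \<le> R1 + \<epsilon> \<and>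
        log 2 (real m2) / real n \<le> R2 + \<epsilon>"
    proof (rule exI[of _ N], intro allI impI)
      fix n assume "N \<le> n"
      then obtain m0 m1 m2 e dx dy where *: "is_code n m0 m1 m2 e" "max (err_x Q n e dx) (err_y Q n e dy) \<le> \<epsilon> / 2"
        "log 2 (real m0) / real n \<le> S0 + \<epsilon> / 2" "log 2 (real m1) / real n \<le> S1 + \<epsilon> / 2"
        "log 2 (real m2) / real n \<le> S2 + \<epsilon> / 2" using N by blast
      have "max (err_x Q n e dx) (err_y Q n e dy) \<le> \<epsilon>" "log 2 (real m0) / real n \<le> R0 + \<epsilon>"
        "log 2 (real m1) / real n \<le> R1 + \<epsilon>" "log 2 (real m2) / real n \<le> R2 + \<epsilon>"
        using *(2-) le \<epsilon> by linarith+
      then show "\<exists>m0 m1 m2 e dx dy. is_code n m0 m1 m2 e \<and>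
        max (err_x Q n e dx) (err_y Q n e dy) \<le> \<epsilon> \<and>
        log 2 (real m0) / real n \<le> R0 + \<epsilon> \<and> log 2 (real m1) / real n \<le> R1 + \<epsilon> \<and>
        log 2 (real m2) / real n \<le> R2 + \<epsilon>" using *(1) by blast
    qed
  qed
qed

theorem theorem2:
  fixes Q :: "('x::finite \<times> 'y::finite \<times> 'u::finite \<times> 'v::finite) pmf"
  assumes "CARD('w::finite) \<le> CARD('x) * CARD('y) + 3"
  shows "closure (\<Union>c \<in> (cond_kernels :: ('x \<Rightarrow> 'y \<Rightarrow> 'w \<Rightarrow> real) set). Rin_p (joint_p c Q))
           \<subseteq> {R. achievable Q R}"
proof (rule closure_minimal[OF _ closed_achievable])
  show "(\<Union>c \<in> (cond_kernels :: ('x \<Rightarrow> 'y \<Rightarrow> 'w \<Rightarrow> real) set). Rin_p (joint_p c Q)) \<subseteq> {R. achievable Q R}"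
    using Rin_p_achievable by fastforce
qed

end
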